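(* Let $(\Omega,\mathcal{F},\mathbb{P})$ be a complete probability space, $t_0<T$, $x_0$ a random variable and $a,b$ stochastic processes on $[t_0,T]$, and let $x(t,\omega)=x_0(\omega)\mathrm{e}^{\int_{t_0}^t a(s,\omega)\mathrm{d} s}+\int_{t_0}^t b(s,\omega)\mathrm{e}^{\int_s^t a(r,\omega)\mathrm{d} r}\mathrm{d} s$. Assume: (H1) $a,b\in \mathrm{L}^2([t_0,T]\times\Omega)$; (H2) for every $N\ge1$, $x_0$, $\eta_1$ and $(\xi_1,\ldots,\xi_N,\eta_2,\ldots,\eta_N)$ are absolutely continuous and independent; (H3) the density $f_{\eta_1}$ of $\eta_1$ is continuous and bounded on $\mathbb{R}$; (H4) $\xi_1,\xi_2,\ldots$ have support in $[-A,A]$ for some $A>0$, and $\psi_1>0$ on $(t_0,T)$. Then for each fixed $t\in(t_0,T]$ and $x\in\mathbb{R}$, the sequence \[ f_1^N(x,t)=\int_{\mathbb{R}^{2N}} f_0\Big(x\,\mathrm{e}^{-K_a(t,\pmb{\xi}_N)}-\int_{t_0}^t S_b(s,\pmb{\eta}_N)\mathrm{e}^{-K_a(s,\pmb{\xi}_N)}\,\mathrm{d} s\Big)f_{\pmb{\xi}_N,\pmb{\eta}_N}(\pmb{\xi}_N,\pmb{\eta}_N)\,\mathrm{e}^{-K_a(t,\pmb{\xi}_N)}\,\mathrm{d} \pmb{\xi}_N\,\mathrm{d} \pmb{\eta}_N \] (where $f_0$ is the density of $x_0$) converges to $f_1(x,t)$, where $f_1(\cdot,t)$ is a probability density of $x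(t,\cdot)$.
   Context: Karhunen–Loève expansions: for $a\in \mathrm{L}^2([t_0,T]\times\Omega)$ write $a(t,\omega)=\mu_a(t)+\sum_{j=1}^\infty\sqrt{\nu_j}\,\phi_j(t)\xi_j(\omega)$ (convergence in $\mathrm{L}^2([t_0,T]\times\Omega)$), where $\mu_a(t)=\mathbb{E}[a(t)]$, $\{(\nu_j,\phi_j)\}$ are the (nonnegative) eigenvalue/eigenfunction pairs of the covariance operator $\mathcal{C}f(t)=\int_{t_0}^T\mathrm{Cov}[a(t),a(s)]f(s)\,\mathrm{d} s$ on $\mathrm{L}^2([t_0,T])$ with $\{\phi_j\}$ an orthonormal basis, and $\xi_j$ are zero-mean, unit-variance, pairwise uncorrelated random variables. Similarly $b(t,\omega)=\mu_b(t)+\sum_{i=1}^\infty\sqrt{\gamma_i}\,\psi_i(t)\eta_i(\omega)$, with $\gamma_1>0$. Pairs may be enumerated in any order; if only finitely many eigenvalues are nonzero, vectors stop at that number. $\pmb{\xi}_N=(\xi_1,\ldots,\xi_N)$, $\pmb{\eta}_N=(\eta_1,\ldots,\eta_N)$, $K_a(t,\pmb{\xi}_N)=\int_{t_0}^t\big(\mu_a(s)+\sum_{j=1}^N\sqrt{\nu_j}\phi_j(s)\xi_j\big)\mathrm{d} s$, $S_b(s,\pmb{\eta}_N)=\mu_b(s)+\sum_{i=1}^N\sqrt{\gamma_i}\psi_i(s)\eta_i$, and $f_{\pmb{\xi}_N,\pmb{\eta}_N}$ is the joint density of $(\xi_1,\ldots,\xi_N,\eta_1,\ldots,\eta_N)$.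 *)

theory Defs
  imports "HOL-Probability.Probability"
begin

text \<open>Index sets of the (truncated) Karhunen-Loeve expansions.  The number of
  nonzero eigenvalues is n (possibly infinite); the terms are numbered 1,2,...\<close>

definition KL_all :: "enat \<Rightarrow> nat set" where
  "KL_all n = {j. 1 \<le> j \<and> enat j \<le> n}"

definition KL_idx :: "enat \<Rightarrow> nat \<Rightarrow> nat set" where
  "KL_idx n N = {j. 1 \<le> j \<and> j \<le> N \<and> enat j \<le> n}"

definition KL_space :: "enat \<Rightarrow> nat \<Rightarrow> (nat \<Rightarrow> real) measure" where
  "KL_space n N = PiM (KL_idx n N) (\<lambda>_. lborel)"

definition L2_on :: "real \<Rightarrow> real \<Rightarrow> (real \<Rightarrow> real) \<Rightarrow> bool" where
  "L2_on t0 T f \<longleftrightarrow> f \<in> borel_measurable (restrict_space lborel {t0..T}) \<and>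
     integrable (restrict_space lborel {t0..T}) (\<lambda>t. (f t)\<^sup>2)"

definition L2_proc :: "'w measure \<Rightarrow> real \<Rightarrow> real \<Rightarrow> (real \<Rightarrow> 'w \<Rightarrow> real) \<Rightarrow> bool" where
  "L2_proc M t0 T a \<longleftrightarrow>
     (\<lambda>(t,\<omega>). a t \<omega>) \<in> borel_measurable (restrict_space lborel {t0..T} \<Otimes>\<^sub>M M) \<and>
     integrable (restrict_space lborel {t0..T} \<Otimes>\<^sub>M M) (\<lambda>(t,\<omega>). (a t \<omega>)\<^sup>2)"

definition mean_fun :: "'w measure \<Rightarrow> (real \<Rightarrow> 'w \<Rightarrow> real) \<Rightarrow> real \<Rightarrow> real" where
  "mean_fun M a t = (\<integral>\<omega>. a t \<omega> \<partial>M)"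

definition cov_fun :: "'w measure \<Rightarrow> (real \<Rightarrow> 'w \<Rightarrow> real) \<Rightarrow> real \<Rightarrow> real \<Rightarrow> real" where
  "cov_fun M a t s = (\<integral>\<omega>. (a t \<omega> - mean_fun M a t) * (a s \<omega> - mean_fun M a s) \<partial>M)"

definition cov_op :: "'w measure \<Rightarrow> real \<Rightarrow> real \<Rightarrow> (real \<Rightarrow> 'w \<Rightarrow> real) \<Rightarrow> (real \<Rightarrow> real) \<Rightarrow> real \<Rightarrow> real" where
  "cov_op M t0 T a f t = (\<integral>s\<in>{t0..T}. cov_fun M a t s * f s \<partial>lborel)"

text \<open>Karhunen-Loeve expansion a = mu_a + sum_j sqrt(nu_j) phi_j xi_j, j ranging over the
  nonzero eigenvalues of the covariance operator (n of them, n possibly infinite):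
  (nu_j, phi_j) are eigenpairs with nu_j > 0, the phi_j are orthonormal in L^2[t0,T] and
  complete for the nonzero part of the spectrum (every f orthogonal to all phi_j is in
  the kernel of C, i.e. the phi_j complete to an orthonormal basis with eigenfunctions
  of eigenvalue 0), the xi_j are zero-mean, unit-variance, pairwise uncorrelated, and
  the expansion converges in L^2([t0,T] x Omega).\<close>
definition KL_expansion ::
  "'w measure \<Rightarrow> real \<Rightarrow> real \<Rightarrow> (real \<Rightarrow> 'w \<Rightarrow> real) \<Rightarrow> enat \<Rightarrow> (nat \<Rightarrow> real)
     \<Rightarrow> (nat \<Rightarrow> real \<Rightarrow> real) \<Rightarrow> (nat \<Rightarrow> 'w \<Rightarrow> real) \<Rightarrow> bool" where
  "KL_expansion M t0 T a n \<nu> \<phi> \<xi> \<longleftrightarrow>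
     (\<forall>j\<in>KL_all n. 0 < \<nu> j) \<and>
     (\<forall>j\<in>KL_all n. L2_on t0 T (\<phi> j)) \<and>
     (\<forall>i\<in>KL_all n. \<forall>j\<in>KL_all n.
        (\<integral>t\<in>{t0..T}. \<phi> i t * \<phi> j t \<partial>lborel) = (if i = j then 1 else 0)) \<and>
     (\<forall>j\<in>KL_all n. AE t in lborel. t \<in> {t0..T} \<longrightarrow> cov_op M t0 T a (\<phi> j) t = \<nu> j * \<phi> j t) \<and>
     (\<forall>f. L2_on t0 T f \<and> (\<forall>j\<in>KL_all n. (\<integral>t\<in>{t0..T}. f t * \<phi> j t \<partial>lborel) = 0) \<longrightarrow>
        (AE t in lborel. t \<in> {t0..T} \<longrightarrow> cov_op M t0 T a f t = 0)) \<and>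
     (\<forall>j\<in>KL_all n. \<xi> j \<in> borel_measurable M \<and> integrable M (\<lambda>\<omega>. (\<xi> j \<omega>)\<^sup>2) \<and>
        (\<integral>\<omega>. \<xi> j \<omega> \<partial>M) = 0) \<and>
     (\<forall>i\<in>KL_all n. \<forall>j\<in>KL_all n. (\<integral>\<omega>. \<xi> i \<omega> * \<xi> j \<omega> \<partial>M) = (if i = j then 1 else 0)) \<and>
     ((\<lambda>N. \<integral>p. (a (fst p) (snd p) - mean_fun M a (fst p)
              - (\<Sum>j\<in>KL_idx n N. sqrt (\<nu> j) * \<phi> j (fst p) * \<xi> j (snd p)))\<^sup>2
           \<partial>(restrict_space lborel {t0..T} \<Otimes>\<^sub>M M)) \<longlonglongrightarrow> 0)"

text \<open>Mutual independence of three random variables with values in different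
  measurable spaces (the definition of indep_vars, which needs a common codomain type,
  written out for three differently typed variables).\<close>
definition indep3 :: "'w measure \<Rightarrow> 'a measure \<Rightarrow> ('w \<Rightarrow> 'a) \<Rightarrow> 'b measure \<Rightarrow> ('w \<Rightarrow> 'b)
    \<Rightarrow> 'c measure \<Rightarrow> ('w \<Rightarrow> 'c) \<Rightarrow> bool" where
  "indep3 M Ma X Mb Y Mc Z \<longleftrightarrow>
     X \<in> measurable M Ma \<and> Y \<in> measurable M Mb \<and> Z \<in> measurable M Mc \<and>
     prob_space.indep_sets M
       (\<lambda>k::nat. if k = 0 then {X -` E \<inter> space M | E. E \<in> sets Ma}
                 else if k = 1 then {Y -` E \<inter> space M | E. E \<in> sets Mb}
                 else {Z -` E \<inter> space M | E. E \<in> sets Mc}) {0, 1, 2}"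

definition sol_proc :: "real \<Rightarrow> ('w \<Rightarrow> real) \<Rightarrow> (real \<Rightarrow> 'w \<Rightarrow> real) \<Rightarrow> (real \<Rightarrow> 'w \<Rightarrow> real)
    \<Rightarrow> real \<Rightarrow> 'w \<Rightarrow> real" where
  "sol_proc t0 x0 a b t \<omega> =
     x0 \<omega> * exp (\<integral>s\<in>{t0..t}. a s \<omega> \<partial>lborel)
     + (\<integral>s\<in>{t0..t}. b s \<omega> * exp (\<integral>r\<in>{s..t}. a r \<omega> \<partial>lborel) \<partial>lborel)"

definition K_fun :: "real \<Rightarrow> (real \<Rightarrow> real) \<Rightarrow> enat \<Rightarrow> (nat \<Rightarrow> real) \<Rightarrow> (nat \<Rightarrow> real \<Rightarrow> real)
    \<Rightarrow> nat \<Rightarrow> real \<Rightarrow> (nat \<Rightarrow> real) \<Rightarrow> real" where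
  "K_fun t0 \<mu> n \<nu> \<phi> N t z =
     (\<integral>s\<in>{t0..t}. \<mu> s + (\<Sum>j\<in>KL_idx n N. sqrt (\<nu> j) * \<phi> j s * z j) \<partial>lborel)"

definition S_fun :: "(real \<Rightarrow> real) \<Rightarrow> enat \<Rightarrow> (nat \<Rightarrow> real) \<Rightarrow> (nat \<Rightarrow> real \<Rightarrow> real)
    \<Rightarrow> nat \<Rightarrow> real \<Rightarrow> (nat \<Rightarrow> real) \<Rightarrow> real" where
  "S_fun \<mu> n \<gamma> \<psi> N s w = \<mu> s + (\<Sum>i\<in>KL_idx n N. sqrt (\<gamma> i) * \<psi> i s * w i)"

definition f1_approx ::
  "real \<Rightarrow> (real \<Rightarrow> real) \<Rightarrow> ((nat \<Rightarrow> real) \<times> (nat \<Rightarrow> real) \<Rightarrow> real)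
   \<Rightarrow> (real \<Rightarrow> real) \<Rightarrow> enat \<Rightarrow> (nat \<Rightarrow> real) \<Rightarrow> (nat \<Rightarrow> real \<Rightarrow> real)
   \<Rightarrow> (real \<Rightarrow> real) \<Rightarrow> enat \<Rightarrow> (nat \<Rightarrow> real) \<Rightarrow> (nat \<Rightarrow> real \<Rightarrow> real)
   \<Rightarrow> nat \<Rightarrow> real \<Rightarrow> real \<Rightarrow> real" where
  "f1_approx t0 f0 fJ \<mu>a na \<nu> \<phi> \<mu>b nb \<gamma> \<psi> N x t =
     (\<integral>p. f0 (x * exp (- K_fun t0 \<mu>a na \<nu> \<phi> N t (fst p))
               - (\<integral>s\<in>{t0..t}. S_fun \<mu>b nb \<gamma> \<psi> N s (snd p)
                     * exp (- K_fun t0 \<mu>a na \<nu> \<phi> N s (fst p)) \<partial>lborel))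
           * fJ p * exp (- K_fun t0 \<mu>a na \<nu> \<phi> N t (fst p))
        \<partial>(KL_space na N \<Otimes>\<^sub>M KL_space nb N))"

end

theory Submission
  imports Defs
begin

text \<open>
  Write \<open>k\<close>, \<open>S\<close> for the truncations of \<open>\<integral>a\<close> and \<open>b\<close>, \<open>X\<close> for the corresponding truncated solution,
  \<open>D = \<integral> sqrt \<gamma>\<^sub>1 \<psi>\<^sub>1 exp (- k)\<close> (over \<open>[t0, t]\<close>) for the coefficient of \<open>\<eta>\<^sub>1\<close> in
  \<open>\<integral> S exp (- k)\<close>, and \<open>W = exp (- k t) / D\<close>.
  Since \<open>x0\<close>, \<open>\<eta>\<^sub>1\<close> and the remaining coefficients are independent, an affine substitution in the
  \<open>\<eta>\<^sub>1\<close> variable moves the density \<open>f0\<close>, which is merely measurable, out of the formula: the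
  approximation equals \<open>E [f\<eta>1 (\<eta>\<^sub>1 + (x - X) W) W]\<close>, and this is also a density of \<open>X\<close>.
  Because the \<open>\<xi>\<^sub>j\<close> are bounded, Bessel's inequality and the summability of the eigenvalues bound
  \<open>k\<close> by a deterministic constant, uniformly in the truncation; hence \<open>W\<close> is bounded as well.
  Along subsequences the L2 convergence of the expansions gives pathwise L1 convergence almost
  surely, so \<open>X\<close> and \<open>W\<close> converge, and bounded convergence yields the limit of the approximations.
  That the limit is a density of the solution follows from Fatou's lemma on open sets.
\<close>

section \<open>Passing to the limit in densities\<close>

text \<open>Convergence in mean yields almost sure convergence only along subsequences; this
  criterion leads back to the whole sequence. Otherwise infinitely many indices would keep a fixed
  distance from \<open>l\<close>, and no subsequence of these could tend to
  \<open>l\<close>.\<close>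

lemma LIMSEQ_subsubseqI:
  fixes u :: "nat \<Rightarrow> 'a::metric_space"
  assumes "\<And>r :: nat \<Rightarrow> nat. strict_mono r \<Longrightarrow> \<exists>s. strict_mono s \<and> (\<lambda>n. u (r (s n))) \<longlonglongrightarrow> l"
  shows "u \<longlonglongrightarrow> l"
proof (rule ccontr)
  assume "\<not> u \<longlonglongrightarrow> l"
  then obtain e where e: "e > 0" "\<And>N. \<exists>n\<ge>N. e \<le> dist (u n) l"
    by (auto simp: lim_sequentially not_less)
  then have "infinite {n. e \<le> dist (u n) l}"
    by (auto simp: infinite_nat_iff_unbounded_le)
  then obtain r :: "nat \<Rightarrow> nat" where r: "strict_mono r" "\<And>n. e \<le> dist (u (r n)) l"
    by (auto dest: infinite_enumerate)
  obtain s where s: "strict_mono s" "(\<lambda>n. u (r (s n))) \<longlonglongrightarrow> l"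
    using assms[OF r(1)] by auto
  from s(2) e(1) have "eventually (\<lambda>n. dist (u (r (s n))) l < e) sequentially"
    by (simp add: tendsto_iff)
  then obtain n where "dist (u (r (s n))) l < e"
    by (auto dest: eventually_happens)
  with r(2)[of "s n"] show False by simp
qed

text \<open>Outer regularity carries the inequality from open sets to all Borel sets. Applied to a
  set and to its complement it must be an equality, because the two values add up to 1 for
  \<open>P\<close> and to at most 1 for \<open>F\<close>.\<close>

lemma prob_measure_eqI_le_open:
  fixes P F :: "real measure"
  assumes P: "prob_space P" and sets[measurable_cong]: "sets P = sets borel" "sets F = sets borel"
    and F: "emeasure F UNIV \<le> 1"
    and le: "\<And>U. open U \<Longrightarrow> emeasure P U \<le> emeasure F U"
  shows "P = F"
proof -
  interpret P: prob_space P by fact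
  have spF: "space F = UNIV" "space P = UNIV"
    using sets_eq_imp_space_eq[OF sets(1)] sets_eq_imp_space_eq[OF sets(2)] by auto
  interpret F: finite_measure F
    using F spF by (intro finite_measureI) (auto simp: top_unique)
  have *: "emeasure P B \<le> emeasure F B" if "B \<in> sets borel" for B
  proof -
    have "emeasure F B = (INF U\<in>{U. B \<subseteq> U \<and> open U}. emeasure F U)"
      by (rule outer_regular) (use that F spF in \<open>auto simp: sets top_unique\<close>)
    also have "\<dots> \<ge> emeasure P B"
      by (intro INF_greatest order_trans[OF emeasure_mono le]) (auto simp: sets)
    finally show ?thesis .
  qed
  show ?thesis
  proof (rule measure_eqI)
    fix B assume "B \<in> sets P"
    then have B: "B \<in> sets borel" by (simp add: sets)
    then have B': "- B \<in> sets borel" by (simp add: Compl_in_sets_lebesgue borel_comp)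
    have "1 = measure P B + measure P (- B)"
      using P.prob_compl[of B] B sets spF by (simp add: Compl_eq_Diff_UNIV)
    moreover have "measure F B + measure F (- B) \<le> 1"
    proof -
      have "measure F UNIV \<le> 1" 
        using F by (simp add: F.emeasure_eq_measure flip: ennreal_1)
      then show ?thesis
        using F.finite_measure_compl[of B] B sets spF by (simp add: Compl_eq_Diff_UNIV)
    qed
    moreover have "measure P B \<le> measure F B" "measure P (-B) \<le> measure F (-B)"
      using *[OF B] *[OF B'] by (simp_all add: F.emeasure_eq_measure P.emeasure_eq_measure)
    ultimately have "measure P B = measure F B" by linarith
    then show "emeasure P B = emeasure F B" 
      by (simp add: F.emeasure_eq_measure P.emeasure_eq_measure)
  qed (simp add: sets)
qed

text \<open>Lower semicontinuity of the indicator of an open set; together with Fatou's lemma it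
  gives the open-set half of the portmanteau theorem.\<close>

lemma indicator_open_le_liminf:
  fixes u :: "nat \<Rightarrow> 'a::topological_space"
  assumes "open U" "u \<longlonglongrightarrow> l"
  shows "(indicator U l :: ennreal) \<le> liminf (\<lambda>n. indicator U (u n))"
proof (cases "l \<in> U")
  case True
  have "eventually (\<lambda>n. u n \<in> U) sequentially"
    using assms True by (auto simp: tendsto_def)
  then have "eventually (\<lambda>n. 1 \<le> (indicator U (u n) :: ennreal)) sequentially"
    by eventually_elim simp
  with True show ?thesis by (auto intro!: Liminf_bounded)
qed simp

text \<open>The integrands are bounded by \<open>B * c\<close>, so the densities converge at every
  \<open>x\<close>. Pointwise convergence alone would allow mass to escape; comparing the law of
  \<open>X\<close> with the limit on open sets shows that none is lost. The assumption on
  subsequences is the form in which L2 convergence supplies pathwise limits.\<close>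

lemma distributed_limit:
  fixes X W :: "'w \<Rightarrow> real" and XN WN :: "nat \<Rightarrow> 'w \<Rightarrow> real" and f :: "real \<Rightarrow> real"
  assumes P: "prob_space M"
    and [measurable]: "\<And>n. XN n \<in> borel_measurable M" "\<And>n. WN n \<in> borel_measurable M"
      "X \<in> borel_measurable M" "W \<in> borel_measurable M" "Y \<in> borel_measurable M"
    and f: "continuous_on UNIV f" "\<And>x. 0 \<le> f x" "\<And>x. f x \<le> B"
    and WN: "\<And>n. AE \<omega> in M. 0 \<le> WN n \<omega> \<and> WN n \<omega> \<le> c"
    and sub: "\<And>r :: nat \<Rightarrow> nat. strict_mono r \<Longrightarrow> \<exists>s. strict_mono s \<and>
       (AE \<omega> in M. (\<lambda>n. XN (r (s n)) \<omega>) \<longlonglongrightarrow> X \<omega> \<and> (\<lambda>n. WN (r (s n)) \<omega>) \<longlonglongrightarrow> W \<omega>)"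
    and dens: "\<And>n. distributed M lborel (XN n)
        (\<lambda>x. ennreal (\<integral>\<omega>. f (Y \<omega> + (x - XN n \<omega>) * WN n \<omega>) * WN n \<omega> \<partial>M))"
  shows "AE \<omega> in M. 0 \<le> W \<omega>"
    and "(\<lambda>n. \<integral>\<omega>. f (Y \<omega> + (x - XN n \<omega>) * WN n \<omega>) * WN n \<omega> \<partial>M)
           \<longlonglongrightarrow> (\<integral>\<omega>. f (Y \<omega> + (x - X \<omega>) * W \<omega>) * W \<omega> \<partial>M)"
    and "distributed M lborel X (\<lambda>x. ennreal (\<integral>\<omega>. f (Y \<omega> + (x - X \<omega>) * W \<omega>) * W \<omega> \<partial>M))"
proof -
  interpret prob_space M by fact
  have [measurable]: "f \<in> borel_measurable borel"
    using f(1) by (rule borel_measurable_continuous_onI)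
  define gN where "gN n x = (\<integral>\<omega>. f (Y \<omega> + (x - XN n \<omega>) * WN n \<omega>) * WN n \<omega> \<partial>M)" for n x
  define g where "g x = (\<integral>\<omega>. f (Y \<omega> + (x - X \<omega>) * W \<omega>) * W \<omega> \<partial>M)" for x
  have [measurable]: "gN n \<in> borel_measurable borel" "g \<in> borel_measurable borel" for n
    unfolding gN_def g_def by measurable
  have B0: "0 \<le> B" using f(2,3)[of 0] by linarith
  have WN': "AE \<omega> in M. \<forall>n. 0 \<le> WN n \<omega> \<and> WN n \<omega> \<le> c"
    using WN by (simp add: AE_all_countable)
  have bnd: "\<bar>f y * w\<bar> \<le> B * c" if "0 \<le> w" "w \<le> c" for y w
    using that f(2,3)[of y] B0 by (simp add: abs_mult mult_mono)
  have lim: "(\<lambda>n. gN n x) \<longlonglongrightarrow> g x" for x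
  proof (rule LIMSEQ_subsubseqI)
    fix r :: "nat \<Rightarrow> nat" assume "strict_mono r"
    then obtain s where s: "strict_mono s"
      "AE \<omega> in M. (\<lambda>n. XN (r (s n)) \<omega>) \<longlonglongrightarrow> X \<omega> \<and> (\<lambda>n. WN (r (s n)) \<omega>) \<longlonglongrightarrow> W \<omega>"
      using sub by blast
    have "(\<lambda>n. gN (r (s n)) x) \<longlonglongrightarrow> g x"
      unfolding gN_def g_def
    proof (rule integral_dominated_convergence[where w="\<lambda>_. B * c"])
      show "AE \<omega> in M. (\<lambda>n. f (Y \<omega> + (x - XN (r (s n)) \<omega>) * WN (r (s n)) \<omega>) * WN (r (s n)) \<omega>)
          \<longlonglongrightarrow> f (Y \<omega> + (x - X \<omega>) * W \<omega>) * W \<omega>"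
        using s(2)
      proof eventually_elim
        case (elim \<omega>)
        then show ?case
          by (intro tendsto_intros continuous_on_tendsto_compose[OF f(1)]) auto
      qed
      show "AE \<omega> in M. norm (f (Y \<omega> + (x - XN (r (s n)) \<omega>) * WN (r (s n)) \<omega>) * WN (r (s n)) \<omega>) \<le> B * c" for n
        using WN' by eventually_elim (simp add: bnd)
    qed auto
    with s(1) show "\<exists>s. strict_mono s \<and> (\<lambda>n. gN (r (s n)) x) \<longlonglongrightarrow> g x" by blast
  qed
  then show "(\<lambda>n. \<integral>\<omega>. f (Y \<omega> + (x - XN n \<omega>) * WN n \<omega>) * WN n \<omega> \<partial>M)
           \<longlonglongrightarrow> (\<integral>\<omega>. f (Y \<omega> + (x - X \<omega>) * W \<omega>) * W \<omega> \<partial>M)"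
    by (simp add: gN_def g_def)
  \<comment> \<open>Starting from the identity gives one almost surely convergent subsequence, which
    is enough to identify the law of \<open>X\<close>.\<close>
  obtain s where s: "strict_mono s"
      "AE \<omega> in M. (\<lambda>n. XN (s n) \<omega>) \<longlonglongrightarrow> X \<omega> \<and> (\<lambda>n. WN (s n) \<omega>) \<longlonglongrightarrow> W \<omega>"
    using sub[OF strict_mono_id] by (auto simp: id_def)
  show "AE \<omega> in M. 0 \<le> W \<omega>"
    using s(2) WN' by eventually_elim (auto intro: LIMSEQ_le_const)
  have gN0: "0 \<le> gN n x" for n x
    unfolding gN_def using WN[of n] by (intro integral_nonneg_AE) (auto elim!: eventually_mono simp: f)
  have gNB: "gN n x \<le> B * c" for n x
  proof -
    have "AE \<omega> in M. 0 \<le> c" using WN[of n] by eventually_elim simp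
    then have "0 \<le> c" by simp
    moreover have "AE \<omega> in M. \<bar>f (Y \<omega> + (x - XN n \<omega>) * WN n \<omega>) * WN n \<omega>\<bar> \<le> B * c"
      using WN[of n] by eventually_elim (simp add: bnd)
    ultimately have "\<bar>gN n x\<bar> \<le> (\<integral>\<omega>. B * c \<partial>M)" unfolding gN_def
      using B0 by (intro integral_abs_bound[THEN order_trans] integral_mono_AE') auto
    then show ?thesis by (simp add: prob_space)
  qed
  have elim_dens: "emeasure M (XN n -` U \<inter> space M) = (\<integral>\<^sup>+x. ennreal (gN n x) * indicator U x \<partial>lborel)"
    if "U \<in> sets borel" for n U
    using distributed_emeasure[OF dens[of n], of U] that by (simp add: gN_def)
  define F where "F = density lborel (\<lambda>x. ennreal (g x))"
  have "distr M lborel X = F"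
  proof (rule prob_measure_eqI_le_open)
    show "prob_space (distr M lborel X)" by (rule prob_space_distr) simp
    show "sets (distr M lborel X) = sets borel" "sets F = sets borel" by (simp_all add: F_def)
    \<comment> \<open>Fatou's lemma: every \<open>gN n\<close> has total integral 1, so the
      pointwise limit has at most 1.\<close>
    have "emeasure F UNIV = (\<integral>\<^sup>+x. liminf (\<lambda>n. ennreal (gN n x)) \<partial>lborel)"
      unfolding F_def using lim
      by (auto simp: emeasure_density intro!: nn_integral_cong lim_imp_Liminf[symmetric] tendsto_ennrealI)
    also have "\<dots> \<le> liminf (\<lambda>n. \<integral>\<^sup>+x. ennreal (gN n x) \<partial>lborel)"
      by (rule nn_integral_liminf) simp
    also have "(\<lambda>n. \<integral>\<^sup>+x. ennreal (gN n x) \<partial>lborel) = (\<lambda>n. 1)"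
      using elim_dens[of UNIV] by (simp add: emeasure_space_1)
    finally show "emeasure F UNIV \<le> 1" by (simp add: Liminf_const)
    fix U :: "real set" assume U: "open U"
    \<comment> \<open>On a bounded set the constant \<open>B * c\<close> is an integrable majorant,
      so the probabilities that \<open>XN (s n)\<close> lies in \<open>V\<close> converge to the
      \<open>F\<close>-mass of \<open>V\<close>; Fatou's lemma bounds the probability for
      \<open>X\<close> by this limit.\<close>
    have bounded: "emeasure (distr M lborel X) V \<le> emeasure F V" if V: "open V" "bounded V" for V
    proof -
      have [measurable]: "V \<in> sets borel" using V by simp
      have "emeasure (distr M lborel X) V = (\<integral>\<^sup>+\<omega>. indicator V (X \<omega>) \<partial>M)"
        by (subst emeasure_distr) (auto simp flip: nn_integral_indicator intro!: nn_integral_cong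
            split: split_indicator)
      also have "\<dots> \<le> (\<integral>\<^sup>+\<omega>. liminf (\<lambda>n. indicator V (XN (s n) \<omega>)) \<partial>M)"
        using s(2) by (intro nn_integral_mono_AE) (auto elim!: eventually_mono
            intro!: indicator_open_le_liminf V)
      also have "\<dots> \<le> liminf (\<lambda>n. \<integral>\<^sup>+\<omega>. indicator V (XN (s n) \<omega>) \<partial>M)"
        by (rule nn_integral_liminf) simp
      also have "(\<lambda>n. \<integral>\<^sup>+\<omega>. indicator V (XN (s n) \<omega>) \<partial>M)
          = (\<lambda>n. \<integral>\<^sup>+x. ennreal (gN (s n) x) * indicator V x \<partial>lborel)"
        by (subst elim_dens[symmetric]) (auto simp flip: nn_integral_indicator intro!: nn_integral_cong
            split: split_indicator)
      also have "liminf \<dots> = (\<integral>\<^sup>+x. ennreal (g x) * indicator V x \<partial>lborel)"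
      proof (intro lim_imp_Liminf nn_integral_dominated_convergence[where w="\<lambda>x. ennreal (B*c) * indicator V x"])
        show "AE x in lborel. ennreal (gN (s j) x) * indicator V x \<le> ennreal (B*c) * indicator V x" for j
          by (auto intro!: mult_right_mono ennreal_leI gNB)
        show "(\<integral>\<^sup>+x. ennreal (B*c) * indicator V x \<partial>lborel) < \<infinity>"
          using emeasure_bounded_finite[OF V(2)] by (simp add: nn_integral_cmult_indicator ennreal_mult_less_top)
        show "AE x in lborel. (\<lambda>n. ennreal (gN (s n) x) * indicator V x) \<longlonglongrightarrow> ennreal (g x) * indicator V x"
        proof (intro AE_I2 )
          fix x 
          have "(\<lambda>n. gN (s n) x) \<longlonglongrightarrow> g x"
            using LIMSEQ_subseq_LIMSEQ[OF lim s(1)] by (simp add: o_def)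
          then show "(\<lambda>n. ennreal (gN (s n) x) * indicator V x) \<longlonglongrightarrow> ennreal (g x) * indicator V x"
            by (auto intro!: tendsto_ennrealI split: split_indicator)
        qed
      qed simp_all
      also have "\<dots> = emeasure F V" by (simp add: F_def emeasure_density)
      finally show ?thesis .
    qed
    \<comment> \<open>Exhaustion by balls extends the inequality to unbounded open sets, by
      continuity from below on both sides.\<close>
    have Un: "U = (\<Union>n::nat. U \<inter> ball 0 (real n))" 
      by (auto simp: dist_norm) (metis reals_Archimedean2)
    have inc: "incseq (\<lambda>n::nat. U \<inter> ball 0 (real n))"
      by (auto simp: incseq_def)
    have "emeasure (distr M lborel X) U = (SUP n::nat. emeasure (distr M lborel X) (U \<inter> ball 0 (real n)))"
      using U inc by (subst Un, subst SUP_emeasure_incseq) auto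
    also have "\<dots> \<le> (SUP n::nat. emeasure F (U \<inter> ball 0 (real n)))"
      using U by (intro SUP_subset_mono bounded) auto
    also have "\<dots> = emeasure F U"
      using U inc by (subst (2) Un, subst SUP_emeasure_incseq) (auto simp: F_def)
    finally show "emeasure (distr M lborel X) U \<le> emeasure F U" .
  qed
  then show "distributed M lborel X (\<lambda>x. ennreal (\<integral>\<omega>. f (Y \<omega> + (x - X \<omega>) * W \<omega>) * W \<omega> \<partial>M))"
    unfolding F_def g_def[symmetric] by (simp add: distributed_def)
qed

section \<open>Affine functions of independent variables\<close>

lemma indep3_emeasure:
  assumes P: "prob_space M" and ind: "indep3 M Ma X Mb Y Mc Z"
    and A: "A \<in> sets Ma" and B: "B \<in> sets Mb" and C: "C \<in> sets Mc"
  shows "emeasure M {\<omega>\<in>space M. X \<omega> \<in> A \<and> Y \<omega> \<in> B \<and> Z \<omega> \<in> C}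
     = emeasure M {\<omega>\<in>space M. X \<omega> \<in> A} * emeasure M {\<omega>\<in>space M. Y \<omega> \<in> B} * emeasure M {\<omega>\<in>space M. Z \<omega> \<in> C}"
proof -
  interpret prob_space M by fact
  define E where "E k = (if k = 0 then X -` A \<inter> space M else if k = 1 then Y -` B \<inter> space M
      else Z -` C \<inter> space M)" for k :: nat
  have "prob (\<Inter>k\<in>{0,1,2}. E k) = (\<Prod>k\<in>{0,1,2::nat}. prob (E k))"
  proof -
    let ?G = "\<lambda>k::nat. if k = 0 then {X -` E \<inter> space M | E. E \<in> sets Ma}
                 else if k = 1 then {Y -` E \<inter> space M | E. E \<in> sets Mb}
                 else {Z -` E \<inter> space M | E. E \<in> sets Mc}"
    have "indep_sets ?G {0, 1, 2}" using ind by (simp add: indep3_def)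
    moreover have "E \<in> Pi {0, 1, 2} ?G"
      unfolding E_def Pi_def using A B C by auto
    ultimately show ?thesis
      unfolding indep_sets_def by (meson finite.emptyI finite.insertI insert_not_empty order_refl)
  qed
  moreover have "(\<Inter>k\<in>{0,1,2}. E k) = {\<omega>\<in>space M. X \<omega> \<in> A \<and> Y \<omega> \<in> B \<and> Z \<omega> \<in> C}"
    by (auto simp: E_def)
  moreover have "E 0 = {\<omega>\<in>space M. X \<omega> \<in> A}" "E 1 = {\<omega>\<in>space M. Y \<omega> \<in> B}" "E 2 = {\<omega>\<in>space M. Z \<omega> \<in> C}"
    by (auto simp: E_def)
  ultimately show ?thesis
    by (simp add: emeasure_eq_measure ennreal_mult'' mult.assoc)
qed

text \<open>Uniqueness of product measures is used twice. With \<open>A\<close> fixed, the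
  probability of \<open>X \<in> A\<close> and \<open>(Y, Z) \<in> D\<close> is a measure in
  \<open>D\<close>, determined by the boxes \<open>B \<times> C\<close>, where the assumed
  factorization applies. After that, general \<open>D\<close> are available and the sets
  \<open>A \<times> D\<close> determine the joint law.\<close>

lemma distr_pair_indep:
  assumes P: "prob_space M"
    and [measurable]: "X \<in> measurable M Ma" "Y \<in> measurable M Mb" "Z \<in> measurable M Mc"
    and eq: "\<And>A B C. A \<in> sets Ma \<Longrightarrow> B \<in> sets Mb \<Longrightarrow> C \<in> sets Mc \<Longrightarrow>
      emeasure M {\<omega>\<in>space M. X \<omega> \<in> A \<and> Y \<omega> \<in> B \<and> Z \<omega> \<in> C}
     = emeasure M {\<omega>\<in>space M. X \<omega> \<in> A} * emeasure M {\<omega>\<in>space M. Y \<omega> \<in> B} * emeasure M {\<omega>\<in>space M. Z \<omega> \<in> C}"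
  shows "distr M Ma X \<Otimes>\<^sub>M distr M (Mb \<Otimes>\<^sub>M Mc) (\<lambda>\<omega>. (Y \<omega>, Z \<omega>))
     = distr M (Ma \<Otimes>\<^sub>M (Mb \<Otimes>\<^sub>M Mc)) (\<lambda>\<omega>. (X \<omega>, Y \<omega>, Z \<omega>))"
proof -
  interpret prob_space M by fact
  interpret PX: prob_space "distr M Ma X" by (rule prob_space_distr) simp
  interpret PY: prob_space "distr M Mb Y" by (rule prob_space_distr) simp
  interpret PZ: prob_space "distr M Mc Z" by (rule prob_space_distr) simp
  interpret PYZ: prob_space "distr M (Mb \<Otimes>\<^sub>M Mc) (\<lambda>\<omega>. (Y \<omega>, Z \<omega>))" by (rule prob_space_distr) simp
  have set_eq: "f -` S \<inter> space M = {\<omega>\<in>space M. f \<omega> \<in> S}" for f :: "'a \<Rightarrow> 'x" and S by auto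
  \<comment> \<open>Restricting \<open>M\<close> to the event \<open>X \<in> A\<close> by a density
    and taking the image under \<open>(Y, Z)\<close> realizes the measure in \<open>D\<close> for
    fixed \<open>A\<close>.\<close>
  have emX: "emeasure (distr (density M (indicator {\<omega>\<in>space M. X \<omega> \<in> A})) (Mb \<Otimes>\<^sub>M Mc) (\<lambda>\<omega>. (Y \<omega>, Z \<omega>))) D
      = emeasure M {\<omega>\<in>space M. X \<omega> \<in> A \<and> (Y \<omega>, Z \<omega>) \<in> D}"
    if A[measurable]: "A \<in> sets Ma" and D[measurable]: "D \<in> sets (Mb \<Otimes>\<^sub>M Mc)" for A D
  proof -
    have "emeasure (distr (density M (indicator {\<omega>\<in>space M. X \<omega> \<in> A})) (Mb \<Otimes>\<^sub>M Mc) (\<lambda>\<omega>. (Y \<omega>, Z \<omega>))) D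
       = emeasure (density M (indicator {\<omega>\<in>space M. X \<omega> \<in> A})) {\<omega>\<in>space M. (Y \<omega>, Z \<omega>) \<in> D}"
      by (subst emeasure_distr) (auto intro!: arg_cong2[where f=emeasure])
    also have "\<dots> = (\<integral>\<^sup>+\<omega>. indicator {\<omega>\<in>space M. X \<omega> \<in> A \<and> (Y \<omega>, Z \<omega>) \<in> D} \<omega> \<partial>M)"
      by (subst emeasure_density, measurable) (rule nn_integral_cong, auto split: split_indicator)
    also have "\<dots> = emeasure M {\<omega>\<in>space M. X \<omega> \<in> A \<and> (Y \<omega>, Z \<omega>) \<in> D}"
      by (rule nn_integral_indicator) measurable
    finally show ?thesis .
  qed
  have cond: "emeasure (distr (density M (indicator {\<omega>\<in>space M. X \<omega> \<in> A})) (Mb \<Otimes>\<^sub>M Mc) (\<lambda>\<omega>. (Y \<omega>, Z \<omega>))) D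
     = emeasure M {\<omega>\<in>space M. X \<omega> \<in> A} * emeasure (distr M Mb Y \<Otimes>\<^sub>M distr M Mc Z) D"
    if A[measurable]: "A \<in> sets Ma" and D[measurable]: "D \<in> sets (Mb \<Otimes>\<^sub>M Mc)" for A D
  proof -
    let ?p = "emeasure M {\<omega>\<in>space M. X \<omega> \<in> A}"
    \<comment> \<open>The probability of \<open>X \<in> A\<close> is absorbed into the first
      marginal, so that the candidate is still a product of two finite measures.\<close>
    interpret S: finite_measure "scale_measure ?p (distr M Mb Y)"
      by (rule finite_measureI)
        (use PY.emeasure_space_1 in \<open>simp add: space_scale_measure emeasure_eq_measure ennreal_mult_eq_top_iff\<close>)
    have "scale_measure ?p (distr M Mb Y) \<Otimes>\<^sub>M distr M Mc Z
      = distr (density M (indicator {\<omega>\<in>space M. X \<omega> \<in> A})) (Mb \<Otimes>\<^sub>M Mc) (\<lambda>\<omega>. (Y \<omega>, Z \<omega>))"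
    proof (rule pair_measure_eqI)
      fix B C assume "B \<in> sets (scale_measure ?p (distr M Mb Y))" "C \<in> sets (distr M Mc Z)"
      then have [measurable]: "B \<in> sets Mb" "C \<in> sets Mc" by auto
      show "emeasure (scale_measure ?p (distr M Mb Y)) B * emeasure (distr M Mc Z) C = 
         emeasure (distr (density M (indicator {\<omega>\<in>space M. X \<omega> \<in> A})) (Mb \<Otimes>\<^sub>M Mc) (\<lambda>\<omega>. (Y \<omega>, Z \<omega>))) (B \<times> C)"
        by (subst emX) (simp_all add: eq emeasure_distr set_eq)
    qed (rule S.sigma_finite_measure_axioms, rule PZ.sigma_finite_measure_axioms, simp cong: sets_pair_measure_cong)
    then have "emeasure (distr (density M (indicator {\<omega>\<in>space M. X \<omega> \<in> A})) (Mb \<Otimes>\<^sub>M Mc) (\<lambda>\<omega>. (Y \<omega>, Z \<omega>))) D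
      = emeasure (scale_measure ?p (distr M Mb Y) \<Otimes>\<^sub>M distr M Mc Z) D" by simp
    also have "\<dots> = ?p * emeasure (distr M Mb Y \<Otimes>\<^sub>M distr M Mc Z) D"
      by (subst (1 2) PZ.emeasure_pair_measure)
        (simp_all add: nn_integral_scale_measure cong: sets_pair_measure_cong)
    finally show ?thesis .
  qed
  show ?thesis
  proof (rule pair_measure_eqI)
    fix A D assume "A \<in> sets (distr M Ma X)" "D \<in> sets (distr M (Mb \<Otimes>\<^sub>M Mc) (\<lambda>\<omega>. (Y \<omega>, Z \<omega>)))"
    then have [measurable]: "A \<in> sets Ma" "D \<in> sets (Mb \<Otimes>\<^sub>M Mc)" by auto
    \<comment> \<open>The case \<open>A = space Ma\<close> shows that the law of
      \<open>(Y, Z)\<close> is the product of the two marginals.\<close>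
    have "X \<omega> \<in> space Ma" if "\<omega> \<in> space M" for \<omega> using that by (rule measurable_space[rotated]) simp
    then have "{\<omega>\<in>space M. (Y \<omega>, Z \<omega>) \<in> D} = {\<omega>\<in>space M. X \<omega> \<in> space Ma \<and> (Y \<omega>, Z \<omega>) \<in> D}"
      "{\<omega>\<in>space M. X \<omega> \<in> space Ma} = space M" by auto
    then have "emeasure M {\<omega>\<in>space M. (Y \<omega>, Z \<omega>) \<in> D} = emeasure (distr M Mb Y \<Otimes>\<^sub>M distr M Mc Z) D"
      using cond[of "space Ma" D] emX[of "space Ma" D] by (simp add: emeasure_space_1)
    moreover have "emeasure M {\<omega>\<in>space M. X \<omega> \<in> A \<and> (Y \<omega>, Z \<omega>) \<in> D}
       = emeasure M {\<omega>\<in>space M. X \<omega> \<in> A} * emeasure (distr M Mb Y \<Otimes>\<^sub>M distr M Mc Z) D"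
      using cond[of A D] emX[of A D] by simp
    ultimately show "emeasure (distr M Ma X) A * emeasure (distr M (Mb \<Otimes>\<^sub>M Mc) (\<lambda>\<omega>. (Y \<omega>, Z \<omega>))) D
      = emeasure (distr M (Ma \<Otimes>\<^sub>M (Mb \<Otimes>\<^sub>M Mc)) (\<lambda>\<omega>. (X \<omega>, Y \<omega>, Z \<omega>))) (A \<times> D)"
      by (simp add: emeasure_distr set_eq)
  qed (rule PX.sigma_finite_measure_axioms, rule PYZ.sigma_finite_measure_axioms, simp cong: sets_pair_measure_cong)
qed

text \<open>By \<open>distr_pair_indep\<close> the joint law is a product, and Tonelli's theorem
  allows the variable that has a density to be integrated first.\<close>

lemma nn_integral_indep_density:
  assumes P: "prob_space M" and X: "distributed M lborel X f"
    and [measurable]: "Y \<in> measurable M Mb" "Z \<in> measurable M Mc"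
    and eq: "\<And>A B C. A \<in> sets lborel \<Longrightarrow> B \<in> sets Mb \<Longrightarrow> C \<in> sets Mc \<Longrightarrow>
      emeasure M {\<omega>\<in>space M. X \<omega> \<in> A \<and> Y \<omega> \<in> B \<and> Z \<omega> \<in> C}
     = emeasure M {\<omega>\<in>space M. X \<omega> \<in> A} * emeasure M {\<omega>\<in>space M. Y \<omega> \<in> B} * emeasure M {\<omega>\<in>space M. Z \<omega> \<in> C}"
    and h[measurable]: "h \<in> borel_measurable (lborel \<Otimes>\<^sub>M (Mb \<Otimes>\<^sub>M Mc))"
  shows "(\<integral>\<^sup>+\<omega>. h (X \<omega>, Y \<omega>, Z \<omega>) \<partial>M) = (\<integral>\<^sup>+\<omega>. (\<integral>\<^sup>+x. f x * h (x, Y \<omega>, Z \<omega>) \<partial>lborel) \<partial>M)"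
proof -
  interpret prob_space M by fact
  have [measurable]: "X \<in> measurable M lborel" "f \<in> borel_measurable lborel" "X \<in> borel_measurable M"
    using X by (auto simp: distributed_def)
  let ?D = "distr M (Mb \<Otimes>\<^sub>M Mc) (\<lambda>\<omega>. (Y \<omega>, Z \<omega>))"
  interpret PX: prob_space "distr M lborel X" by (rule prob_space_distr) simp
  interpret PYZ: prob_space ?D by (rule prob_space_distr) simp
  interpret PP: pair_sigma_finite "distr M lborel X" ?D ..
  have [measurable_cong]: "sets (distr M lborel X \<Otimes>\<^sub>M ?D) = sets (lborel \<Otimes>\<^sub>M (Mb \<Otimes>\<^sub>M Mc))"
    by (intro sets_pair_measure_cong) auto
  have "(\<integral>\<^sup>+\<omega>. h (X \<omega>, Y \<omega>, Z \<omega>) \<partial>M) = (\<integral>\<^sup>+p. h p \<partial>distr M (lborel \<Otimes>\<^sub>M (Mb \<Otimes>\<^sub>M Mc)) (\<lambda>\<omega>. (X \<omega>, Y \<omega>, Z \<omega>)))"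
    by (subst nn_integral_distr) auto
  also have "\<dots> = (\<integral>\<^sup>+p. h p \<partial>(distr M lborel X \<Otimes>\<^sub>M ?D))"
    by (subst distr_pair_indep[OF P _ _ _ eq]) (simp_all add: measurable_lborel2)
  also have "\<dots> = (\<integral>\<^sup>+p. (\<integral>\<^sup>+x. h (x, p) \<partial>distr M lborel X) \<partial>?D)"
    by (subst PP.nn_integral_snd[symmetric]) auto
  also have "\<dots> = (\<integral>\<^sup>+p. (\<integral>\<^sup>+x. f x * h (x, p) \<partial>lborel) \<partial>?D)"
    unfolding distributed_distr_eq_density[OF X]
    by (intro nn_integral_cong) (auto simp: nn_integral_density)
  also have "\<dots> = (\<integral>\<^sup>+\<omega>. (\<integral>\<^sup>+x. f x * h (x, Y \<omega>, Z \<omega>) \<partial>lborel) \<partial>M)"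
    by (subst nn_integral_distr) auto
  finally show ?thesis .
qed

text \<open>\<open>Y \<omega> + (x - X \<omega>) * W \<omega>\<close> is the value of
  \<open>Y\<close> that would make \<open>X\<close> equal to \<open>x\<close> with the other
  variables fixed, and \<open>W\<close> is its derivative in \<open>x\<close>. So the integrand on
  the right is the conditional density of \<open>X\<close> at \<open>x\<close> given
  \<open>x0\<close> and \<open>Z\<close>. For the first identity \<open>Y\<close> is integrated out
  and the argument of \<open>f0\<close> becomes the new variable, which is then read as
  \<open>x0\<close>.\<close>

lemma affine_indep_density:
  fixes x0 Y :: "'w \<Rightarrow> real" and f0 f :: "real \<Rightarrow> real" and \<kappa> q d :: "'c \<Rightarrow> real"
  assumes P: "prob_space M"
    and f0: "\<And>x. 0 \<le> f0 x" "distributed M lborel x0 (\<lambda>x. ennreal (f0 x))"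
    and f: "\<And>x. 0 \<le> f x" "distributed M lborel Y (\<lambda>x. ennreal (f x))"
    and ind: "indep3 M lborel x0 lborel Y Mc Z"
    and [measurable]: "\<kappa> \<in> borel_measurable Mc" "q \<in> borel_measurable Mc" "d \<in> borel_measurable Mc"
    and d: "\<And>z. z \<in> space Mc \<Longrightarrow> 0 < d z"
  defines "X \<equiv> \<lambda>\<omega>. exp (\<kappa> (Z \<omega>)) * (x0 \<omega> + q (Z \<omega>) + d (Z \<omega>) * Y \<omega>)"
    and "W \<equiv> \<lambda>\<omega>. exp (- \<kappa> (Z \<omega>)) / d (Z \<omega>)"
  shows "(\<integral>\<^sup>+\<omega>. ennreal (f0 (x * exp (- \<kappa> (Z \<omega>)) - (q (Z \<omega>) + d (Z \<omega>) * Y \<omega>)) * exp (- \<kappa> (Z \<omega>))) \<partial>M)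
          = (\<integral>\<^sup>+\<omega>. ennreal (f (Y \<omega> + (x - X \<omega>) * W \<omega>) * W \<omega>) \<partial>M)"
    and "distributed M lborel X (\<lambda>x. \<integral>\<^sup>+\<omega>. ennreal (f (Y \<omega> + (x - X \<omega>) * W \<omega>) * W \<omega>) \<partial>M)"
proof -
  interpret prob_space M by fact
  have Z[measurable]: "Z \<in> measurable M Mc" using ind by (simp add: indep3_def)
  have [measurable]: "x0 \<in> borel_measurable M" "Y \<in> borel_measurable M"
    using f0 f by (auto simp: distributed_def)
  have mf0[measurable]: "f0 \<in> borel_measurable borel"
    using distributed_real_measurable[OF _ f0(2)] f0(1) by simp
  have mf[measurable]: "f \<in> borel_measurable borel"
    using distributed_real_measurable[OF _ f(2)] f(1) by simp
  have dZ: "0 < d (Z \<omega>)" if "\<omega> \<in> space M" for \<omega>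
    using d measurable_space[OF Z that] .
  note ex = indep3_emeasure[OF P ind]
  \<comment> \<open>Exchanging the roles of \<open>x0\<close> and \<open>Y\<close> lets either of
    them be the variable that is integrated first.\<close>
  have ey: "emeasure M {\<omega>\<in>space M. Y \<omega> \<in> A \<and> x0 \<omega> \<in> B \<and> Z \<omega> \<in> C}
     = emeasure M {\<omega>\<in>space M. Y \<omega> \<in> A} * emeasure M {\<omega>\<in>space M. x0 \<omega> \<in> B} * emeasure M {\<omega>\<in>space M. Z \<omega> \<in> C}"
    if "A \<in> sets lborel" "B \<in> sets lborel" "C \<in> sets Mc" for A B C
  proof -
    have "{\<omega>\<in>space M. Y \<omega> \<in> A \<and> x0 \<omega> \<in> B \<and> Z \<omega> \<in> C} = {\<omega>\<in>space M. x0 \<omega> \<in> B \<and> Y \<omega> \<in> A \<and> Z \<omega> \<in> C}"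
      by auto
    then show ?thesis using ex[OF that(2,1,3)] by (simp add: mult_ac)
  qed
  have WX: "Y \<omega> + (x - X \<omega>) * W \<omega> = (x * exp (- \<kappa> (Z \<omega>)) - x0 \<omega> - q (Z \<omega>)) / d (Z \<omega>)"
    if "\<omega> \<in> space M" for \<omega> x
    using dZ[OF that] by (simp add: X_def W_def field_simps exp_minus)
  have nY: "(\<integral>\<^sup>+\<omega>. h (Y \<omega>, x0 \<omega>, Z \<omega>) \<partial>M) = (\<integral>\<^sup>+\<omega>. (\<integral>\<^sup>+y. ennreal (f y) * h (y, x0 \<omega>, Z \<omega>) \<partial>lborel) \<partial>M)"
    if "h \<in> borel_measurable (lborel \<Otimes>\<^sub>M (lborel \<Otimes>\<^sub>M Mc))" for h
    by (rule nn_integral_indep_density[OF P f(2) _ _ ey that]) simp_all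
  have nX: "(\<integral>\<^sup>+\<omega>. h (x0 \<omega>, Y \<omega>, Z \<omega>) \<partial>M) = (\<integral>\<^sup>+\<omega>. (\<integral>\<^sup>+y. ennreal (f0 y) * h (y, Y \<omega>, Z \<omega>) \<partial>lborel) \<partial>M)"
    if "h \<in> borel_measurable (lborel \<Otimes>\<^sub>M (lborel \<Otimes>\<^sub>M Mc))" for h
    by (rule nn_integral_indep_density[OF P f0(2) _ _ ex that]) simp_all
  have "(\<integral>\<^sup>+\<omega>. ennreal (f0 (x * exp (- \<kappa> (Z \<omega>)) - (q (Z \<omega>) + d (Z \<omega>) * Y \<omega>)) * exp (- \<kappa> (Z \<omega>))) \<partial>M)
     = (\<integral>\<^sup>+\<omega>. (\<integral>\<^sup>+y. ennreal (f y) * ennreal (f0 (x * exp (- \<kappa> (Z \<omega>)) - (q (Z \<omega>) + d (Z \<omega>) * y)) * exp (- \<kappa> (Z \<omega>))) \<partial>lborel) \<partial>M)"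
    using nY[of "\<lambda>(y,_,z). ennreal (f0 (x * exp (- \<kappa> z) - (q z + d z * y)) * exp (- \<kappa> z))"] by simp
  also have "\<dots> = (\<integral>\<^sup>+\<omega>. (\<integral>\<^sup>+u. ennreal (f0 u) *
        ennreal (f ((x * exp (- \<kappa> (Z \<omega>)) - u - q (Z \<omega>)) / d (Z \<omega>)) * (exp (- \<kappa> (Z \<omega>)) / d (Z \<omega>))) \<partial>lborel) \<partial>M)"
  proof (rule nn_integral_cong)
    fix \<omega> assume \<omega>: "\<omega> \<in> space M"
    \<comment> \<open>The substitution \<open>u = x * k - (e + D * y)\<close> is affine in
      \<open>y\<close> with slope \<open>- D\<close>; its factor \<open>1 / D\<close> and the factor
      \<open>k\<close> combine to \<open>W\<close>.\<close>
    define k e D where "k = exp (- \<kappa> (Z \<omega>))" and "e = q (Z \<omega>)" and "D = d (Z \<omega>)"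
    have D: "0 < D" and k: "0 < k" using dZ[OF \<omega>] by (auto simp: D_def k_def)
    have "(\<integral>\<^sup>+y. ennreal (f y) * ennreal (f0 (x * k - (e + D * y)) * k) \<partial>lborel)
      = \<bar>- 1 / D\<bar> * (\<integral>\<^sup>+u. ennreal (f ((x * k - e) / D + (- 1 / D) * u)) * ennreal (f0 (x * k - (e + D * ((x * k - e) / D + (- 1 / D) * u))) * k) \<partial>lborel)"
      using D by (intro nn_integral_real_affine) auto
    also have "\<dots> = (\<integral>\<^sup>+u. \<bar>- 1 / D\<bar> * (ennreal (f ((x * k - e) / D + (- 1 / D) * u)) * ennreal (f0 (x * k - (e + D * ((x * k - e) / D + (- 1 / D) * u))) * k)) \<partial>lborel)"
      by (rule nn_integral_cmult[symmetric]) simp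
    also have "\<dots> = (\<integral>\<^sup>+u. ennreal (f0 u) * ennreal (f ((x * k - u - e) / D) * (k / D)) \<partial>lborel)"
    proof (rule nn_integral_cong)
      fix u
      have "x * k - (e + D * ((x * k - e) / D + (- 1 / D) * u)) = u"
        "(x * k - e) / D + (- 1 / D) * u = (x * k - u - e) / D"
        using D by (simp_all add: field_simps)
      then show "\<bar>- 1 / D\<bar> * (ennreal (f ((x * k - e) / D + (- 1 / D) * u)) * ennreal (f0 (x * k - (e + D * ((x * k - e) / D + (- 1 / D) * u))) * k))
         = ennreal (f0 u) * ennreal (f ((x * k - u - e) / D) * (k / D))"
        using D k by (simp add: f f0 mult_ac flip: ennreal_mult)
    qed
    finally show "(\<integral>\<^sup>+y. ennreal (f y) * ennreal (f0 (x * exp (- \<kappa> (Z \<omega>)) - (q (Z \<omega>) + d (Z \<omega>) * y)) * exp (- \<kappa> (Z \<omega>))) \<partial>lborel)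
      = (\<integral>\<^sup>+u. ennreal (f0 u) *
        ennreal (f ((x * exp (- \<kappa> (Z \<omega>)) - u - q (Z \<omega>)) / d (Z \<omega>)) * (exp (- \<kappa> (Z \<omega>)) / d (Z \<omega>))) \<partial>lborel)"
      by (simp only: k_def e_def D_def)
  qed
  \<comment> \<open>Now \<open>u\<close> is weighted by \<open>f0\<close>, so the inner integral is
    undone as an average over \<open>x0\<close>.\<close>
  also have "\<dots> = (\<integral>\<^sup>+\<omega>. ennreal (f ((x * exp (- \<kappa> (Z \<omega>)) - x0 \<omega> - q (Z \<omega>)) / d (Z \<omega>)) * (exp (- \<kappa> (Z \<omega>)) / d (Z \<omega>))) \<partial>M)"
    using nX[of "\<lambda>(u,_,z). ennreal (f ((x * exp (- \<kappa> z) - u - q z) / d z) * (exp (- \<kappa> z) / d z))"] by simp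
  also have "\<dots> = (\<integral>\<^sup>+\<omega>. ennreal (f (Y \<omega> + (x - X \<omega>) * W \<omega>) * W \<omega>) \<partial>M)"
    by (rule nn_integral_cong) (simp add: WX, simp add: W_def)
  finally show "(\<integral>\<^sup>+\<omega>. ennreal (f0 (x * exp (- \<kappa> (Z \<omega>)) - (q (Z \<omega>) + d (Z \<omega>) * Y \<omega>)) * exp (- \<kappa> (Z \<omega>))) \<partial>M)
          = (\<integral>\<^sup>+\<omega>. ennreal (f (Y \<omega> + (x - X \<omega>) * W \<omega>) * W \<omega>) \<partial>M)" .
  have [measurable]: "X \<in> borel_measurable M" "W \<in> borel_measurable M"
    unfolding X_def W_def by measurable
  interpret L: pair_sigma_finite lborel M ..
  let ?g = "\<lambda>x. \<integral>\<^sup>+\<omega>. ennreal (f (Y \<omega> + (x - X \<omega>) * W \<omega>) * W \<omega>) \<partial>M"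
  have "distr M lborel X = density lborel ?g"
  proof (rule measure_eqI)
    fix U assume "U \<in> sets (distr M lborel X)"
    then have [measurable]: "U \<in> sets borel" by simp
    have "emeasure (distr M lborel X) U = (\<integral>\<^sup>+\<omega>. indicator U (X \<omega>) \<partial>M)"
      by (subst emeasure_distr) (auto simp flip: nn_integral_indicator intro!: nn_integral_cong
            split: split_indicator)
    also have "\<dots> = (\<integral>\<^sup>+\<omega>. (\<integral>\<^sup>+y. ennreal (f y) * indicator U (exp (\<kappa> (Z \<omega>)) * (x0 \<omega> + q (Z \<omega>) + d (Z \<omega>) * y)) \<partial>lborel) \<partial>M)"
      using nY[of "\<lambda>(y,u,z). indicator U (exp (\<kappa> z) * (u + q z + d z * y))"] by (simp add: X_def)
    also have "\<dots> = (\<integral>\<^sup>+\<omega>. (\<integral>\<^sup>+x. ennreal (f (Y \<omega> + (x - X \<omega>) * W \<omega>) * W \<omega>) * indicator U x \<partial>lborel) \<partial>M)"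
    proof (rule nn_integral_cong)
      fix \<omega> assume \<omega>: "\<omega> \<in> space M"
      \<comment> \<open>Here the new variable is the value \<open>k * (e + D * y)\<close> taken by
        \<open>X\<close> itself.\<close>
      define k e D where "k = exp (\<kappa> (Z \<omega>))" and "e = x0 \<omega> + q (Z \<omega>)" and "D = d (Z \<omega>)"
      have D: "0 < D" and k: "0 < k" using dZ[OF \<omega>] by (auto simp: D_def k_def)
      have k': "exp (- \<kappa> (Z \<omega>)) = 1 / k" by (simp add: k_def exp_minus inverse_eq_divide)
      have "(\<integral>\<^sup>+y. ennreal (f y) * indicator U (k * (e + D * y)) \<partial>lborel)
        = \<bar>1 / (k * D)\<bar> * (\<integral>\<^sup>+x. ennreal (f (- e / D + 1 / (k * D) * x)) * indicator U (k * (e + D * (- e / D + 1 / (k * D) * x))) \<partial>lborel)"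
        using D k by (intro nn_integral_real_affine) auto
      also have "\<dots> = (\<integral>\<^sup>+x. \<bar>1 / (k * D)\<bar> * (ennreal (f (- e / D + 1 / (k * D) * x)) * indicator U (k * (e + D * (- e / D + 1 / (k * D) * x)))) \<partial>lborel)"
        by (rule nn_integral_cmult[symmetric]) simp
      also have "\<dots> = (\<integral>\<^sup>+x. ennreal (f ((x * (1 / k) - x0 \<omega> - q (Z \<omega>)) / D) * ((1 / k) / D)) * indicator U x \<partial>lborel)"
      proof (rule nn_integral_cong)
        fix x
        have "k * (e + D * (- e / D + 1 / (k * D) * x)) = x"
          "- e / D + 1 / (k * D) * x = (x * (1 / k) - x0 \<omega> - q (Z \<omega>)) / D"
          using D k by (simp_all add: field_simps e_def)
        then show "\<bar>1 / (k * D)\<bar> * (ennreal (f (- e / D + 1 / (k * D) * x)) * indicator U (k * (e + D * (- e / D + 1 / (k * D) * x))))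
          = ennreal (f ((x * (1 / k) - x0 \<omega> - q (Z \<omega>)) / D) * ((1 / k) / D)) * indicator U x"
          using D k by (simp add: f mult_ac flip: ennreal_mult split: split_indicator)
      qed
      finally show "(\<integral>\<^sup>+y. ennreal (f y) * indicator U (exp (\<kappa> (Z \<omega>)) * (x0 \<omega> + q (Z \<omega>) + d (Z \<omega>) * y)) \<partial>lborel)
        = (\<integral>\<^sup>+x. ennreal (f (Y \<omega> + (x - X \<omega>) * W \<omega>) * W \<omega>) * indicator U x \<partial>lborel)"
        unfolding WX[OF \<omega>] unfolding W_def k' by (simp only: k_def e_def D_def)
    qed
    also have "\<dots> = (\<integral>\<^sup>+x. (\<integral>\<^sup>+\<omega>. ennreal (f (Y \<omega> + (x - X \<omega>) * W \<omega>) * W \<omega>) * indicator U x \<partial>M) \<partial>lborel)"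
      by (rule L.Fubini') measurable
    also have "\<dots> = (\<integral>\<^sup>+x. ?g x * indicator U x \<partial>lborel)"
      by (intro nn_integral_cong nn_integral_multc) measurable
    also have "\<dots> = emeasure (density lborel ?g) U"
      by (subst emeasure_density) auto
    finally show "emeasure (distr M lborel X) U = emeasure (density lborel ?g) U" .
  qed simp
  then show "distributed M lborel X ?g"
    by (simp add: distributed_def)
qed

section \<open>Integration over a compact interval\<close>

lemma finite_measure_restrict_lborel: "finite_measure (restrict_space lborel {t0..T::real})"
  by (intro finite_measureI) (simp add: space_restrict_space emeasure_restrict_space emeasure_lborel_Icc_eq)

text \<open>All integrals over subintervals are moved to one fixed finite measure on
  \<open>[t0, T]\<close>; the endpoints survive only in an indicator and can be treated as
  parameters of the integrand.\<close>

lemma set_integral_eq_restrict_space: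
  fixes f :: "real \<Rightarrow> real"
  assumes "t0 \<le> s" "t \<le> T"
  shows "(\<integral>r\<in>{s..t}. f r \<partial>lborel) = (\<integral>r. indicator {s..t} r * f r \<partial>restrict_space lborel {t0..T})"
  using assms
  by (subst integral_restrict_space)
    (auto simp: set_lebesgue_integral_def intro!: Bochner_Integration.integral_cong split: split_indicator)

section \<open>Square-integrable functions and product integrals\<close>

lemma (in pair_sigma_finite) integrable_product_mult:
  fixes f :: "'a \<Rightarrow> real" and g :: "'b \<Rightarrow> real"
  assumes f: "integrable M1 f" and g: "integrable M2 g"
  shows "integrable (M1 \<Otimes>\<^sub>M M2) (\<lambda>p. f (fst p) * g (snd p))"
    and "(\<integral>p. f (fst p) * g (snd p) \<partial>(M1 \<Otimes>\<^sub>M M2)) = (\<integral>x. f x \<partial>M1) * (\<integral>y. g y \<partial>M2)"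
proof -
  have [measurable]: "f \<in> borel_measurable M1" "g \<in> borel_measurable M2" using f g by auto
  show i: "integrable (M1 \<Otimes>\<^sub>M M2) (\<lambda>p. f (fst p) * g (snd p))"
    by (rule Fubini_integrable) (use f g in \<open>auto simp: abs_mult\<close>)
  show "(\<integral>p. f (fst p) * g (snd p) \<partial>(M1 \<Otimes>\<^sub>M M2)) = (\<integral>x. f x \<partial>M1) * (\<integral>y. g y \<partial>M2)"
    using integral_fst'[OF i] by simp
qed

lemma integrable_mult_of_squares:
  fixes f g :: "'a \<Rightarrow> real"
  assumes [measurable]: "f \<in> borel_measurable M" "g \<in> borel_measurable M"
    and "integrable M (\<lambda>x. (f x)\<^sup>2)" "integrable M (\<lambda>x. (g x)\<^sup>2)"
  shows "integrable M (\<lambda>x. f x * g x)"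
proof (rule Bochner_Integration.integrable_bound)
  show "integrable M (\<lambda>x. (f x)\<^sup>2 + (g x)\<^sup>2)" using assms by simp
  have "\<bar>f x * g x\<bar> \<le> (f x)\<^sup>2 + (g x)\<^sup>2" for x
  proof -
    have "2 * (\<bar>f x\<bar> * \<bar>g x\<bar>) \<le> (f x)\<^sup>2 + (g x)\<^sup>2"
      using sum_squares_bound[of "\<bar>f x\<bar>" "\<bar>g x\<bar>"] by (simp add: mult.assoc)
    moreover have "0 \<le> \<bar>f x\<bar> * \<bar>g x\<bar>" by simp
    ultimately show ?thesis unfolding abs_mult by linarith
  qed
  then show "AE x in M. norm (f x * g x) \<le> norm ((f x)\<^sup>2 + (g x)\<^sup>2)" by auto
qed simp

lemma integrable_power2_diff:
  fixes f g :: "'a \<Rightarrow> real"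
  assumes [measurable]: "f \<in> borel_measurable M" "g \<in> borel_measurable M"
    and "integrable M (\<lambda>x. (f x)\<^sup>2)" "integrable M (\<lambda>x. (g x)\<^sup>2)"
  shows "integrable M (\<lambda>x. (f x - g x)\<^sup>2)"
  using assms integrable_mult_of_squares[OF assms] by (simp add: power2_diff mult.assoc)

text \<open>The Cauchy-Schwarz argument in additive form:
  \<open>\<bar>f n x\<bar> \<le> e / 2 + (f n x)\<^sup>2 / (2 * e)\<close> is integrated, with
  \<open>e\<close> small compared to the total mass.\<close>

lemma (in finite_measure) L2_imp_L1_tendsto_0:
  fixes f :: "nat \<Rightarrow> 'a \<Rightarrow> real"
  assumes [measurable]: "\<And>n. f n \<in> borel_measurable M"
    and int: "\<And>n. integrable M (\<lambda>x. (f n x)\<^sup>2)" and lim: "(\<lambda>n. \<integral>x. (f n x)\<^sup>2 \<partial>M) \<longlonglongrightarrow> 0"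
  shows "(\<lambda>n. \<integral>x. \<bar>f n x\<bar> \<partial>M) \<longlonglongrightarrow> 0"
proof (rule LIMSEQ_I)
  fix r :: real assume r: "0 < r"
  \<comment> \<open>The added 1 keeps \<open>V\<close> positive even for the zero measure. With
    \<open>e = r / V\<close> and the integral of the square below \<open>r * e\<close>, the two
    terms contribute at most \<open>r / 2\<close> each, the second strictly less.\<close>
  define V where "V = measure M (space M) + 1"
  have V: "0 < V" "measure M (space M) \<le> V" by (auto simp: V_def add_nonneg_pos)
  define e where "e = r / V"
  have e: "0 < e" using r V by (simp add: e_def)
  obtain N where N: "\<And>n. N \<le> n \<Longrightarrow> \<bar>\<integral>x. (f n x)\<^sup>2 \<partial>M\<bar> < r * e"
    using LIMSEQ_D[OF lim, of "r * e"] r e by auto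
  have "norm ((\<integral>x. \<bar>f n x\<bar> \<partial>M) - 0) < r" if n: "N \<le> n" for n
  proof -
    have int1: "integrable M (f n)" by (rule square_integrable_imp_integrable) (use int in auto)
    have "(\<integral>x. \<bar>f n x\<bar> \<partial>M) \<le> (\<integral>x. e / 2 + (f n x)\<^sup>2 / (2 * e) \<partial>M)"
    proof (rule integral_mono)
      fix x
      have "2 * e * \<bar>f n x\<bar> \<le> e\<^sup>2 + \<bar>f n x\<bar>\<^sup>2" by (rule sum_squares_bound)
      then show "\<bar>f n x\<bar> \<le> e / 2 + (f n x)\<^sup>2 / (2 * e)"
        using e by (simp add: field_simps power2_eq_square)
    qed (use int int1 in auto)
    also have "\<dots> = measure M (space M) * (e / 2) + (\<integral>x. (f n x)\<^sup>2 \<partial>M) / (2 * e)"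
      using int by simp
    also have "\<dots> < V * (e / 2) + r * e / (2 * e)"
    proof (intro add_le_less_mono mult_right_mono divide_strict_right_mono)
      show "(\<integral>x. (f n x)\<^sup>2 \<partial>M) < r * e" using N[OF n] by linarith
    qed (use V e in auto)
    also have "\<dots> = r" using V e by (simp add: e_def)
    finally show ?thesis by (simp add: abs_of_nonneg)
  qed
  then show "\<exists>no. \<forall>n\<ge>no. norm ((\<integral>x. \<bar>f n x\<bar> \<partial>M) - 0) < r" by blast
qed

text \<open>The indefinite integral with base point \<open>t0\<close>. Written with an indicator
  against the measure on \<open>[t0, T]\<close>, it makes sense for every \<open>s\<close> and is
  constant from \<open>T\<close> on, so that its bounds hold for all \<open>s\<close>.\<close>

definition primitive :: "real \<Rightarrow> real \<Rightarrow> (real \<Rightarrow> real) \<Rightarrow> real \<Rightarrow> real" where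
  "primitive t0 T f s = (\<integral>r. indicator {t0..s} r * f r \<partial>restrict_space lborel {t0..T})"

section \<open>Primitives, their exponentials and L1 limits\<close>

context
  fixes t0 T :: real
begin

abbreviation (input) "IR \<equiv> restrict_space lborel {t0..T}"

interpretation IR: finite_measure IR by (rule finite_measure_restrict_lborel)

lemma id_measurable_Icc[measurable]: "(\<lambda>x. x) \<in> borel_measurable IR"
  by (rule measurable_restrict_space1) simp

text \<open>The common source of measurability for integrals with a variable endpoint, a random
  integrand, or both: the integrand is jointly measurable in the parameter and in
  \<open>r\<close>.\<close>

lemma measurable_integral_indicator:
  fixes f :: "real \<Rightarrow> 'x \<Rightarrow> real" and u v :: "'y \<Rightarrow> real"
  assumes f: "(\<lambda>p. f (fst p) (snd p)) \<in> borel_measurable (IR \<Otimes>\<^sub>M X)"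
    and [measurable]: "u \<in> borel_measurable Y" "v \<in> borel_measurable Y" "z \<in> measurable Y X"
  shows "(\<lambda>y. \<integral>r. indicator {u y..v y} r * f r (z y) \<partial>IR) \<in> borel_measurable Y"
proof (rule IR.borel_measurable_lebesgue_integral)
  have [measurable]: "(\<lambda>p. f (snd p) (z (fst p))) \<in> borel_measurable (Y \<Otimes>\<^sub>M IR)"
    using measurable_compose[OF _ f, of "\<lambda>p. (snd p, z (fst p))" "Y \<Otimes>\<^sub>M IR"] by simp
  \<comment> \<open>Written as a conditional on two comparisons, the moving indicator is visibly
    measurable in both variables at once.\<close>
  have "(\<lambda>p. (if u (fst p) \<le> snd p \<and> snd p \<le> v (fst p) then 1 else 0) * f (snd p) (z (fst p)))
       \<in> borel_measurable (Y \<Otimes>\<^sub>M IR)"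
    by measurable
  also have "(\<lambda>p. (if u (fst p) \<le> snd p \<and> snd p \<le> v (fst p) then 1 else 0) * f (snd p) (z (fst p)))
    = (\<lambda>(y, r). indicator {u y..v y} r * f r (z y))"
    by (auto simp: fun_eq_iff split: split_indicator)
  finally show "(\<lambda>(y, r). indicator {u y..v y} r * f r (z y)) \<in> borel_measurable (Y \<Otimes>\<^sub>M IR)" .
qed

lemma primitive_measurable:
  assumes "integrable IR f"
  shows "primitive t0 T f \<in> borel_measurable IR"
proof -
  have [measurable]: "f \<in> borel_measurable IR" using assms by auto
  show ?thesis
    \<comment> \<open>As \<open>f\<close> carries no parameter, a one-point space serves as
      \<open>X\<close>; the only parameter is the endpoint.\<close>
    unfolding primitive_def
    by (rule measurable_integral_indicator[where f="\<lambda>r _. f r" and X="count_space UNIV" and z="\<lambda>_. ()"]) measurable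
qed

lemma integrable_indicator_Icc_mult:
  fixes f :: "real \<Rightarrow> real"
  assumes f: "integrable IR f"
  shows "integrable IR (\<lambda>r. indicator {u..v} r * f r)"
proof (rule Bochner_Integration.integrable_bound[OF f])
  have [measurable]: "f \<in> borel_measurable IR" using f by auto
  have [measurable]: "(indicator {u..v} :: real \<Rightarrow> real) \<in> borel_measurable IR"
    by (rule measurable_restrict_space1) simp
  show "(\<lambda>r. indicator {u..v} r * f r) \<in> borel_measurable IR" by measurable
qed (auto split: split_indicator)

text \<open>The bound does not depend on the endpoints; applied to a difference it turns L1
  convergence of integrands into convergence of their primitives.\<close>

lemma integral_indicator_Icc_bound:
  fixes f :: "real \<Rightarrow> real"
  assumes f: "integrable IR f"
  shows "\<bar>\<integral>r. indicator {u..v} r * f r \<partial>IR\<bar> \<le> (\<integral>r. \<bar>f r\<bar> \<partial>IR)"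
  by (rule order_trans[OF integral_abs_bound], rule integral_mono)
    (auto intro!: integrable_abs integrable_indicator_Icc_mult f split: split_indicator)

lemma primitive_bound:
  "integrable IR f \<Longrightarrow> \<bar>primitive t0 T f s\<bar> \<le> (\<integral>r. \<bar>f r\<bar> \<partial>IR)"
  unfolding primitive_def by (rule integral_indicator_Icc_bound)

lemma abs_mult_exp_le: "- y \<le> C \<Longrightarrow> \<bar>x * exp (- y)\<bar> \<le> exp C * \<bar>x\<bar>" for x y C :: real
  by (simp add: abs_mult mult.commute[of "exp C"] mult_left_mono)

lemma AE_Icc_neq: "AE r in IR. r \<noteq> c"
  using AE_lborel_singleton[of c] by (subst AE_restrict_space_iff) (auto elim: eventually_mono)

lemma integrable_mult_exp_bounded:
  fixes f k :: "real \<Rightarrow> real"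
  assumes f: "integrable IR f" and k[measurable]: "k \<in> borel_measurable IR"
    and C: "\<And>s. s \<in> {t0..T} \<Longrightarrow> \<bar>k s\<bar> \<le> C"
  shows "integrable IR (\<lambda>s. f s * exp (- k s))"
proof (rule Bochner_Integration.integrable_bound)
  show "integrable IR (\<lambda>s. exp C * f s)" using f by simp
  have [measurable]: "f \<in> borel_measurable IR" using f by auto
  show "(\<lambda>s. f s * exp (- k s)) \<in> borel_measurable IR" by measurable
  have "\<bar>f s * exp (- k s)\<bar> \<le> exp C * \<bar>f s\<bar>" if "s \<in> {t0..T}" for s
    using C[OF that] by (intro abs_mult_exp_le) linarith
  then show "AE s in IR. norm (f s * exp (- k s)) \<le> norm (exp C * f s)"
    by (intro AE_I2) (simp add: abs_mult space_restrict_space)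
qed

text \<open>A nonnegative integrand with zero integral vanishes almost everywhere, but this one is
  positive on an open interval of positive length.\<close>

lemma integral_indicator_Icc_pos:
  fixes g :: "real \<Rightarrow> real"
  assumes t: "t0 < t" "t \<le> T" and g: "integrable IR g" and pos: "\<And>s. s \<in> {t0<..<t} \<Longrightarrow> 0 < g s"
  shows "0 < (\<integral>s. indicator {t0..t} s * g s \<partial>IR)"
proof -
  have i: "integrable IR (\<lambda>s. indicator {t0..t} s * g s)" by (rule integrable_indicator_Icc_mult[OF g])
  \<comment> \<open>The sign of \<open>g\<close> at the two endpoints is unknown; they form a null
    set.\<close>
  have ne: "AE s in IR. s \<noteq> t0 \<and> s \<noteq> t"
    using AE_Icc_neq by auto
  have nn: "AE s in IR. 0 \<le> indicator {t0..t} s * g s"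
    using ne by eventually_elim (auto split: split_indicator intro!: less_imp_le[OF pos])
  have "(\<integral>s. indicator {t0..t} s * g s \<partial>IR) \<noteq> 0"
  proof
    assume "(\<integral>s. indicator {t0..t} s * g s \<partial>IR) = 0"
    then have "AE s in IR. indicator {t0..t} s * g s = 0"
      using integral_nonneg_eq_0_iff_AE[OF i nn] by simp
    then have "AE s in IR. s \<notin> {t0<..<t}"
      by eventually_elim (use pos in \<open>force split: split_indicator_asm\<close>)
    then have "AE s in lborel. s \<notin> {t0<..<t}"
      using t by (subst (asm) AE_restrict_space_iff) (auto elim!: eventually_mono)
    then have "emeasure lborel {t0<..<t} = 0"
      by (subst (asm) AE_iff_measurable[of "{t0<..<t}"]) auto
    with t show False by simp
  qed
  with integral_nonneg_AE[OF nn] show ?thesis by linarith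
qed

lemma primitive_diff:
  assumes f: "integrable IR f" and s: "t0 \<le> s" "s \<le> t" "t \<le> T"
  shows "(\<integral>r. indicator {s..t} r * f r \<partial>IR) = primitive t0 T f t - primitive t0 T f s"
proof -
  \<comment> \<open>The closed intervals \<open>{t0..s}\<close> and \<open>{s..t}\<close> share the
    point \<open>s\<close>, which is negligible.\<close>
  have ne: "AE r in IR. r \<noteq> s" by (rule AE_Icc_neq)
  have [measurable]: "f \<in> borel_measurable IR" using f by auto
  have m: "(\<lambda>r. indicator {u..v} r * f r) \<in> borel_measurable IR" for u v
    using integrable_indicator_Icc_mult[OF f] by auto
  have "(\<integral>r. indicator {s..t} r * f r \<partial>IR) = (\<integral>r. indicator {t0..t} r * f r - indicator {t0..s} r * f r \<partial>IR)"
  proof (rule integral_cong_AE)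
    show "AE r in IR. indicator {s..t} r * f r = indicator {t0..t} r * f r - indicator {t0..s} r * f r"
      using ne by eventually_elim (use s in \<open>auto split: split_indicator\<close>)
  qed (intro borel_measurable_diff m)+
  also have "\<dots> = primitive t0 T f t - primitive t0 T f s"
    unfolding primitive_def by (intro Bochner_Integration.integral_diff integrable_indicator_Icc_mult f)
  finally show ?thesis .
qed

lemma primitive_tendsto:
  assumes a: "\<And>n. integrable IR (aN n)" "integrable IR a"
    and alim: "(\<lambda>n. \<integral>s. \<bar>aN n s - a s\<bar> \<partial>IR) \<longlonglongrightarrow> 0"
  shows "(\<lambda>n. primitive t0 T (aN n) s) \<longlonglongrightarrow> primitive t0 T a s"
proof (rule LIM_zero_cancel, rule tendsto_rabs_zero_cancel, rule real_tendsto_sandwich[OF _ _ tendsto_const alim])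
  have "primitive t0 T (aN n) s - primitive t0 T a s = (\<integral>r. indicator {t0..s} r * (aN n r - a r) \<partial>IR)" for n
    unfolding primitive_def right_diff_distrib
    by (subst Bochner_Integration.integral_diff) (auto intro!: integrable_indicator_Icc_mult a)
  then show "\<forall>\<^sub>F n in sequentially. \<bar>primitive t0 T (aN n) s - primitive t0 T a s\<bar> \<le> (\<integral>s. \<bar>aN n s - a s\<bar> \<partial>IR)"
    using integral_indicator_Icc_bound[OF Bochner_Integration.integrable_diff[OF a(1,2)]] by simp
qed auto

text \<open>Writing \<open>bN n\<close> as \<open>(bN n - b) + b\<close> separates two effects. In
  the first term the exponential is bounded by \<open>exp C\<close> and the L1 convergence of
  \<open>bN\<close> suffices; in the second only the exponent varies, and dominated convergence with
  majorant \<open>exp C * \<bar>b s\<bar>\<close> applies.\<close>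

lemma integral_exp_primitive_tendsto:
  assumes a: "\<And>n. integrable IR (aN n)" "integrable IR a"
    and alim: "(\<lambda>n. \<integral>s. \<bar>aN n s - a s\<bar> \<partial>IR) \<longlonglongrightarrow> 0"
    and b: "\<And>n. integrable IR (bN n)" "integrable IR b"
    and blim: "(\<lambda>n. \<integral>s. \<bar>bN n s - b s\<bar> \<partial>IR) \<longlonglongrightarrow> 0"
    and C: "\<And>n s. s \<in> {t0..T} \<Longrightarrow> \<bar>primitive t0 T (aN n) s\<bar> \<le> C"
  shows "(\<lambda>n. \<integral>s. indicator {u..v} s * (bN n s * exp (- primitive t0 T (aN n) s)) \<partial>IR)
     \<longlonglongrightarrow> (\<integral>s. indicator {u..v} s * (b s * exp (- primitive t0 T a s)) \<partial>IR)"
proof -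
  let ?p = "\<lambda>n. primitive t0 T (aN n)"
  have [measurable]: "?p n \<in> borel_measurable IR" "primitive t0 T a \<in> borel_measurable IR" for n
    using a by (auto intro: primitive_measurable)
  have [measurable]: "b \<in> borel_measurable IR" "bN n \<in> borel_measurable IR" for n
    using b by auto
  have [measurable]: "(indicator {u..v} :: real \<Rightarrow> real) \<in> borel_measurable IR"
    by (rule measurable_restrict_space1) simp
  have expC: "\<bar>x * exp (- ?p n s)\<bar> \<le> exp C * \<bar>x\<bar>" if "s \<in> {t0..T}" for n s x
    using C[OF that, of n] by (intro abs_mult_exp_le) linarith
  have i: "integrable IR (\<lambda>s. f s * exp (- ?p n s))" if "integrable IR f" for f n
    using that by (rule integrable_mult_exp_bounded) (auto intro: C)
  have 1: "(\<lambda>n. \<integral>s. indicator {u..v} s * ((bN n s - b s) * exp (- ?p n s)) \<partial>IR) \<longlonglongrightarrow> 0"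
  proof (rule Lim_null_comparison)
    show "(\<lambda>n. exp C * (\<integral>s. \<bar>bN n s - b s\<bar> \<partial>IR)) \<longlonglongrightarrow> 0"
      using tendsto_mult_left[OF blim, of "exp C"] by simp
    have "\<bar>\<integral>s. indicator {u..v} s * ((bN n s - b s) * exp (- ?p n s)) \<partial>IR\<bar> \<le> exp C * (\<integral>s. \<bar>bN n s - b s\<bar> \<partial>IR)" for n
    proof -
      have "\<bar>\<integral>s. indicator {u..v} s * ((bN n s - b s) * exp (- ?p n s)) \<partial>IR\<bar> \<le> (\<integral>s. \<bar>(bN n s - b s) * exp (- ?p n s)\<bar> \<partial>IR)"
        by (intro integral_indicator_Icc_bound i Bochner_Integration.integrable_diff b)
      also have "\<dots> \<le> (\<integral>s. exp C * \<bar>bN n s - b s\<bar> \<partial>IR)"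
      proof (rule integral_mono)
        fix s assume "s \<in> space IR"
        then show "\<bar>(bN n s - b s) * exp (- ?p n s)\<bar> \<le> exp C * \<bar>bN n s - b s\<bar>"
          using expC[of s] by (simp add: space_restrict_space)
      qed (use b in \<open>auto intro!: integrable_abs i\<close>)
      finally show ?thesis using b by simp
    qed
    then show "\<forall>\<^sub>F n in sequentially. norm (\<integral>s. indicator {u..v} s * ((bN n s - b s) * exp (- ?p n s)) \<partial>IR) \<le> exp C * (\<integral>s. \<bar>bN n s - b s\<bar> \<partial>IR)"
      by simp
  qed
  have 2: "(\<lambda>n. \<integral>s. indicator {u..v} s * (b s * exp (- ?p n s)) \<partial>IR)
     \<longlonglongrightarrow> (\<integral>s. indicator {u..v} s * (b s * exp (- primitive t0 T a s)) \<partial>IR)"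
  proof (rule integral_dominated_convergence[where w="\<lambda>s. exp C * \<bar>b s\<bar>"])
    show "integrable IR (\<lambda>s. exp C * \<bar>b s\<bar>)" using b by simp
    show "AE s in IR. (\<lambda>n. indicator {u..v} s * (b s * exp (- ?p n s)))
      \<longlonglongrightarrow> indicator {u..v} s * (b s * exp (- primitive t0 T a s))"
      by (intro AE_I2 tendsto_intros primitive_tendsto[OF a alim])
    show "AE s in IR. norm (indicator {u..v} s * (b s * exp (- ?p n s))) \<le> exp C * \<bar>b s\<bar>" for n
    proof (rule AE_I2)
      fix s assume "s \<in> space IR"
      then have "\<bar>b s * exp (- ?p n s)\<bar> \<le> exp C * \<bar>b s\<bar>" using expC[of s] by (simp add: space_restrict_space)
      then show "norm (indicator {u..v} s * (b s * exp (- ?p n s))) \<le> exp C * \<bar>b s\<bar>"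
        by (simp split: split_indicator)
    qed
  qed simp_all
  have "(\<integral>s. indicator {u..v} s * (bN n s * exp (- ?p n s)) \<partial>IR)
     = (\<integral>s. indicator {u..v} s * ((bN n s - b s) * exp (- ?p n s)) \<partial>IR) + (\<integral>s. indicator {u..v} s * (b s * exp (- ?p n s)) \<partial>IR)" for n
  proof -
    have "(\<integral>s. indicator {u..v} s * (bN n s * exp (- ?p n s)) \<partial>IR)
      = (\<integral>s. indicator {u..v} s * ((bN n s - b s) * exp (- ?p n s)) + indicator {u..v} s * (b s * exp (- ?p n s)) \<partial>IR)"
      by (intro Bochner_Integration.integral_cong) (simp_all add: algebra_simps)
    also have "\<dots> = (\<integral>s. indicator {u..v} s * ((bN n s - b s) * exp (- ?p n s)) \<partial>IR) + (\<integral>s. indicator {u..v} s * (b s * exp (- ?p n s)) \<partial>IR)"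
      by (intro Bochner_Integration.integral_add integrable_indicator_Icc_mult i b Bochner_Integration.integrable_diff)
    finally show ?thesis .
  qed
  with tendsto_add[OF 1 2] show ?thesis by simp
qed

text \<open>Additivity of the integral of \<open>a\<close>, valid on an integrable path, splits the
  exponential over \<open>{s..t}\<close> into a factor in \<open>t\<close> and a factor in
  \<open>s\<close>. This puts the solution into the same form as its truncations.\<close>

lemma sol_proc_eq:
  assumes t: "t0 \<le> t" "t \<le> T" and a: "integrable IR (\<lambda>s. a s \<omega>)"
  shows "sol_proc t0 x0 a b t \<omega> = exp (primitive t0 T (\<lambda>s. a s \<omega>) t) *
    (x0 \<omega> + (\<integral>s. indicator {t0..t} s * (b s \<omega> * exp (- primitive t0 T (\<lambda>s. a s \<omega>) s)) \<partial>IR))"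
proof -
  let ?k = "primitive t0 T (\<lambda>s. a s \<omega>)"
  have "(\<integral>s\<in>{t0..t}. a s \<omega> \<partial>lborel) = ?k t"
    using t by (subst set_integral_eq_restrict_space[of t0 _ _ T]) (auto simp: primitive_def)
  moreover have "(\<integral>s\<in>{t0..t}. b s \<omega> * exp (\<integral>r\<in>{s..t}. a r \<omega> \<partial>lborel) \<partial>lborel)
    = (\<integral>s. exp (?k t) * (indicator {t0..t} s * (b s \<omega> * exp (- ?k s))) \<partial>IR)"
    using t
  proof (subst set_integral_eq_restrict_space[of t0 _ _ T], simp, simp, intro Bochner_Integration.integral_cong refl)
    fix s
    show "indicator {t0..t} s * (b s \<omega> * exp (\<integral>r\<in>{s..t}. a r \<omega> \<partial>lborel)) = exp (?k t) * (indicator {t0..t} s * (b s \<omega> * exp (- ?k s)))"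
    proof (cases "s \<in> {t0..t}")
      case True
      then have "(\<integral>r\<in>{s..t}. a r \<omega> \<partial>lborel) = ?k t - ?k s"
        using t by (subst set_integral_eq_restrict_space[of t0 _ _ T]) (auto simp: primitive_diff[OF a])
      then show ?thesis by (simp add: exp_diff exp_minus divide_inverse)
    qed simp
  qed
  ultimately show ?thesis by (simp add: sol_proc_def distrib_left mult.commute[of "x0 \<omega>"])
qed

end

section \<open>Karhunen-Loeve expansions\<close>

lemma finite_KL_idx[simp]: "finite (KL_idx n N)"
  by (rule finite_subset[of _ "{..N}"]) (auto simp: KL_idx_def)

lemma KL_idx_subset: "KL_idx n N \<subseteq> KL_all n"
  by (auto simp: KL_idx_def KL_all_def)

text \<open>The setting for a single process. It is used once for \<open>a\<close> and once for
  \<open>b\<close>; in the second case \<open>\<nu>\<close>, \<open>\<phi>\<close>,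
  \<open>\<xi>\<close> stand for \<open>\<gamma>\<close>, \<open>\<psi>\<close>,
  \<open>\<eta>\<close>.\<close>

locale KL = prob_space M for M :: "'w measure" +
  fixes t0 T :: real and a :: "real \<Rightarrow> 'w \<Rightarrow> real" and n :: enat and \<nu> :: "nat \<Rightarrow> real"
    and \<phi> :: "nat \<Rightarrow> real \<Rightarrow> real" and \<xi> :: "nat \<Rightarrow> 'w \<Rightarrow> real"
  assumes tT: "t0 < T" and KL: "KL_expansion M t0 T a n \<nu> \<phi> \<xi>" and L2: "L2_proc M t0 T a"
begin

abbreviation "I \<equiv> restrict_space lborel {t0..T}"
abbreviation "\<mu> \<equiv> mean_fun M a"
abbreviation "S \<equiv> S_fun \<mu> n \<nu> \<phi>"
abbreviation "K \<equiv> K_fun t0 \<mu> n \<nu> \<phi>"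

sublocale I: finite_measure I by (rule finite_measure_restrict_lborel)
sublocale IM: pair_sigma_finite I M ..
sublocale IM: finite_measure "I \<Otimes>\<^sub>M M"
  by (rule finite_measure_pair_measure) unfold_locales

lemma space_I[simp]: "space I = {t0..T}" by (simp add: space_restrict_space)

section \<open>Square integrability of the process and of its mean\<close>

lemma a_measurable[measurable]: "(\<lambda>(t,\<omega>). a t \<omega>) \<in> borel_measurable (I \<Otimes>\<^sub>M M)"
  using L2 by (simp add: L2_proc_def)

lemma a_measurable': "(\<lambda>p. a (fst p) (snd p)) \<in> borel_measurable (I \<Otimes>\<^sub>M M)"
  using a_measurable by (simp add: case_prod_unfold)

lemma a_square_integrable: "integrable (I \<Otimes>\<^sub>M M) (\<lambda>p. (a (fst p) (snd p))\<^sup>2)"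
  using L2 by (simp add: L2_proc_def case_prod_unfold)

lemma mean_measurable[measurable]: "\<mu> \<in> borel_measurable I"
  unfolding mean_fun_def by measurable

text \<open>Nonnegativity of the variance bounds the squared mean by the second moment for almost
  every \<open>t\<close>, and Fubini's theorem makes the second moment integrable in time.\<close>

lemma mean_square_integrable: "integrable I (\<lambda>t. (\<mu> t)\<^sup>2)"
proof (rule Bochner_Integration.integrable_bound)
  show "integrable I (\<lambda>t. \<integral>\<omega>. (a t \<omega>)\<^sup>2 \<partial>M)"
    using IM.integrable_fst'[OF a_square_integrable] by simp
  have "AE t in I. integrable M (\<lambda>\<omega>. (a t \<omega>)\<^sup>2)"
    using IM.AE_integrable_fst'[OF a_square_integrable] by simp
  then show "AE t in I. norm ((\<mu> t)\<^sup>2) \<le> norm (\<integral>\<omega>. (a t \<omega>)\<^sup>2 \<partial>M)"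
    using AE_space
  proof eventually_elim
    case (elim t)
    then have [measurable]: "a t \<in> borel_measurable M"
      using measurable_compose[OF measurable_Pair1' a_measurable] by simp
    have "integrable M (a t)" by (rule square_integrable_imp_integrable) (use elim in auto)
    then have "variance (a t) = (\<integral>\<omega>. (a t \<omega>)\<^sup>2 \<partial>M) - (\<mu> t)\<^sup>2"
      using elim by (simp add: variance_eq mean_fun_def)
    then show ?case using variance_positive[of "a t"] by simp
  qed
qed simp

lemma mean_integrable: "integrable I \<mu>"
  by (rule I.square_integrable_imp_integrable) (use mean_square_integrable in auto)

section \<open>Orthonormal systems and truncated expansions\<close>

lemma \<phi>_measurable: "j \<in> KL_all n \<Longrightarrow> \<phi> j \<in> borel_measurable I"
  and \<phi>_square_integrable: "j \<in> KL_all n \<Longrightarrow> integrable I (\<lambda>t. (\<phi> j t)\<^sup>2)"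
  using KL by (auto simp: KL_expansion_def L2_on_def)

lemma \<phi>_integrable: "j \<in> KL_all n \<Longrightarrow> integrable I (\<phi> j)"
  by (rule I.square_integrable_imp_integrable) (use \<phi>_measurable \<phi>_square_integrable in auto)

lemma \<phi>_mult_integrable:
  "i \<in> KL_all n \<Longrightarrow> j \<in> KL_all n \<Longrightarrow> integrable I (\<lambda>t. \<phi> i t * \<phi> j t)"
  by (rule integrable_mult_of_squares) (use \<phi>_measurable \<phi>_square_integrable in auto)

lemma \<phi>_orthonormal:
  "i \<in> KL_all n \<Longrightarrow> j \<in> KL_all n \<Longrightarrow> (\<integral>t. \<phi> i t * \<phi> j t \<partial>I) = (if i = j then 1 else 0)"
  using KL by (simp add: KL_expansion_def integral_restrict_space set_lebesgue_integral_def)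

lemma \<xi>_measurable: "j \<in> KL_all n \<Longrightarrow> \<xi> j \<in> borel_measurable M"
  and \<xi>_square_integrable: "j \<in> KL_all n \<Longrightarrow> integrable M (\<lambda>t. (\<xi> j t)\<^sup>2)"
  and \<xi>_orthonormal: "i \<in> KL_all n \<Longrightarrow> j \<in> KL_all n \<Longrightarrow> (\<integral>\<omega>. \<xi> i \<omega> * \<xi> j \<omega> \<partial>M) = (if i = j then 1 else 0)"
  and \<nu>_pos: "j \<in> KL_all n \<Longrightarrow> 0 < \<nu> j"
  using KL by (auto simp: KL_expansion_def)

lemma \<xi>_mult_integrable:
  "i \<in> KL_all n \<Longrightarrow> j \<in> KL_all n \<Longrightarrow> integrable M (\<lambda>t. \<xi> i t * \<xi> j t)"
  by (rule integrable_mult_of_squares) (use \<xi>_measurable \<xi>_square_integrable in auto)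

lemma S_integrable: "integrable I (\<lambda>s. S N s z)"
  unfolding S_fun_def using KL_idx_subset[of n N]
  by (intro Bochner_Integration.integrable_add mean_integrable Bochner_Integration.integrable_sum
      integrable_mult_left integrable_mult_right \<phi>_integrable) auto

text \<open>The coefficients enter through an arbitrary measurable map \<open>z\<close>, because
  they occur both as random variables and as coordinates on a product space.\<close>

lemma S_measurable:
  assumes "\<And>j. j \<in> KL_idx n N \<Longrightarrow> (\<lambda>x. z x j) \<in> borel_measurable X"
  shows "(\<lambda>p. S N (fst p) (z (snd p))) \<in> borel_measurable (I \<Otimes>\<^sub>M X)"
  unfolding S_fun_def
proof (intro borel_measurable_add borel_measurable_sum borel_measurable_times)
  fix j assume j: "j \<in> KL_idx n N"
  show "(\<lambda>p. \<phi> j (fst p)) \<in> borel_measurable (I \<Otimes>\<^sub>M X)"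
    by (rule measurable_compose[OF measurable_fst \<phi>_measurable]) (use j KL_idx_subset in blast)
  show "(\<lambda>p. z (snd p) j) \<in> borel_measurable (I \<Otimes>\<^sub>M X)"
    by (rule measurable_compose[OF measurable_snd assms[OF j]])
qed (auto intro: measurable_compose[OF measurable_fst mean_measurable])

lemma K_eq: "s \<in> {t0..T} \<Longrightarrow> K N s z = (\<integral>r. indicator {t0..s} r * S N r z \<partial>I)"
  unfolding K_fun_def S_fun_def by (subst set_integral_eq_restrict_space[of t0 _ _ T]) auto

text \<open>Separating the \<open>z j\<close> from the integrals of the \<open>\<phi> j\<close>
  exposes the Fourier coefficients of an indicator, to which Bessel's inequality applies.\<close>

lemma K_expand:
  assumes s: "s \<in> {t0..T}"
  shows "K N s z = (\<integral>r. indicator {t0..s} r * \<mu> r \<partial>I)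
     + (\<Sum>j\<in>KL_idx n N. sqrt (\<nu> j) * (\<integral>r. indicator {t0..s} r * \<phi> j r \<partial>I) * z j)"
proof -
  have "K N s z = (\<integral>r. indicator {t0..s} r * \<mu> r
     + (\<Sum>j\<in>KL_idx n N. sqrt (\<nu> j) * z j * (indicator {t0..s} r * \<phi> j r)) \<partial>I)"
    unfolding K_eq[OF s] S_fun_def
    by (intro Bochner_Integration.integral_cong) (auto simp: distrib_left sum_distrib_left mult_ac)
  also have "\<dots> = (\<integral>r. indicator {t0..s} r * \<mu> r \<partial>I)
     + (\<integral>r. (\<Sum>j\<in>KL_idx n N. sqrt (\<nu> j) * z j * (indicator {t0..s} r * \<phi> j r)) \<partial>I)"
    using KL_idx_subset[of n N]
    by (intro Bochner_Integration.integral_add Bochner_Integration.integrable_sum integrable_mult_right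
      integrable_indicator_Icc_mult mean_integrable \<phi>_integrable) auto
  also have "(\<integral>r. (\<Sum>j\<in>KL_idx n N. sqrt (\<nu> j) * z j * (indicator {t0..s} r * \<phi> j r)) \<partial>I)
      = (\<Sum>j\<in>KL_idx n N. \<integral>r. sqrt (\<nu> j) * z j * (indicator {t0..s} r * \<phi> j r) \<partial>I)"
    using KL_idx_subset[of n N]
    by (intro Bochner_Integration.integral_sum integrable_mult_right
      integrable_indicator_Icc_mult \<phi>_integrable) auto
  finally show ?thesis by (simp add: mult_ac)
qed

text \<open>The squared distance in L2 between the indicator of \<open>{t0..s}\<close> and its
  projection onto the span of finitely many \<open>\<phi> j\<close> is nonnegative; the squared norm
  of the indicator is \<open>s - t0\<close>.\<close>

lemma Bessel_indicator:
  assumes s: "s \<in> {t0..T}"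
  shows "(\<Sum>j\<in>KL_idx n N. (\<integral>r. indicator {t0..s} r * \<phi> j r \<partial>I)\<^sup>2) \<le> T - t0"
proof -
  define J where "J = KL_idx n N"
  have J: "finite J" "\<And>j. j \<in> J \<Longrightarrow> j \<in> KL_all n" using KL_idx_subset[of n N] by (auto simp: J_def)
  define c where "c j = (\<integral>r. indicator {t0..s} r * \<phi> j r \<partial>I)" for j
  define e :: "real \<Rightarrow> real" where "e r = indicator {t0..s} r" for r
  have ei: "integrable I e" unfolding e_def
    using integrable_indicator_Icc_mult[where f="\<lambda>_. 1" and u=t0 and v=s] by simp
  have e\<phi>: "integrable I (\<lambda>r. e r * \<phi> j r)" if "j \<in> J" for j
    unfolding e_def using that by (intro integrable_indicator_Icc_mult \<phi>_integrable J)
  have "0 \<le> (\<integral>r. (e r - (\<Sum>j\<in>J. c j * \<phi> j r))\<^sup>2 \<partial>I)" by simp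
  also have "(\<lambda>r. (e r - (\<Sum>j\<in>J. c j * \<phi> j r))\<^sup>2)
     = (\<lambda>r. e r - 2 * (\<Sum>j\<in>J. c j * (e r * \<phi> j r)) + (\<Sum>i\<in>J. \<Sum>j\<in>J. c i * c j * (\<phi> i r * \<phi> j r)))"
  proof
    fix r
    \<comment> \<open>The square of \<open>e r\<close> is \<open>e r\<close> itself, hence the
      linear leading term.\<close>
    have "(e r - (\<Sum>j\<in>J. c j * \<phi> j r))\<^sup>2 = e r - 2 * (e r * (\<Sum>j\<in>J. c j * \<phi> j r))
        + (\<Sum>j\<in>J. c j * \<phi> j r) * (\<Sum>j\<in>J. c j * \<phi> j r)"
      by (simp add: power2_eq_square algebra_simps e_def split: split_indicator)
    also have "\<dots> = e r - 2 * (\<Sum>j\<in>J. c j * (e r * \<phi> j r)) + (\<Sum>i\<in>J. \<Sum>j\<in>J. c i * c j * (\<phi> i r * \<phi> j r))"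
      unfolding sum_product by (simp add: sum_distrib_left mult_ac)
    finally show "(e r - (\<Sum>j\<in>J. c j * \<phi> j r))\<^sup>2 = \<dots>" .
  qed
  also have "(\<integral>r. e r - 2 * (\<Sum>j\<in>J. c j * (e r * \<phi> j r)) + (\<Sum>i\<in>J. \<Sum>j\<in>J. c i * c j * (\<phi> i r * \<phi> j r)) \<partial>I)
     = (\<integral>r. e r \<partial>I) - 2 * (\<Sum>j\<in>J. c j * (\<integral>r. e r * \<phi> j r \<partial>I))
       + (\<Sum>i\<in>J. \<Sum>j\<in>J. c i * c j * (\<integral>r. \<phi> i r * \<phi> j r \<partial>I))"
    using ei e\<phi> J by (simp add: \<phi>_mult_integrable)
  also have "\<dots> = (\<integral>r. e r \<partial>I) - (\<Sum>j\<in>J. (c j)\<^sup>2)"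
    using J by (simp add: \<phi>_orthonormal e_def flip: c_def) (simp add: power2_eq_square sum_distrib_left if_distrib sum.delta cong: if_cong)
  also have "(\<integral>r. e r \<partial>I) = s - t0"
    using s unfolding e_def by (subst integral_restrict_space) (auto simp flip: indicator_inter_arith simp: Int_absorb1)
  finally show ?thesis using s by (simp add: J_def c_def)
qed

section \<open>The L2 remainder and the sum of the eigenvalues\<close>

lemma centered_square_integrable:
  "integrable (I \<Otimes>\<^sub>M M) (\<lambda>p. (a (fst p) (snd p) - \<mu> (fst p))\<^sup>2)"
proof (rule integrable_power2_diff)
  show "(\<lambda>p. a (fst p) (snd p)) \<in> borel_measurable (I \<Otimes>\<^sub>M M)"
    by (rule a_measurable')
  show "integrable (I \<Otimes>\<^sub>M M) (\<lambda>p. (\<mu> (fst p))\<^sup>2)"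
    using IM.integrable_product_mult(1)[OF mean_square_integrable, of "\<lambda>_. 1"] by simp
qed (auto intro: a_square_integrable measurable_compose[OF measurable_fst mean_measurable])

text \<open>Each term of the expanded square is a function of time times a random variable, so its
  integral factorizes, and orthonormality of both systems leaves only the diagonal.\<close>

lemma partial_sum_square:
  defines "u N \<equiv> \<lambda>p. (\<Sum>j\<in>KL_idx n N. sqrt (\<nu> j) * \<phi> j (fst p) * \<xi> j (snd p))"
  shows "u N \<in> borel_measurable (I \<Otimes>\<^sub>M M)"
    and "integrable (I \<Otimes>\<^sub>M M) (\<lambda>p. (u N p)\<^sup>2)"
    and "(\<integral>p. (u N p)\<^sup>2 \<partial>(I \<Otimes>\<^sub>M M)) = (\<Sum>j\<in>KL_idx n N. \<nu> j)"
proof -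
  define J where "J = KL_idx n N"
  have J: "finite J" "\<And>j. j \<in> J \<Longrightarrow> j \<in> KL_all n" using KL_idx_subset[of n N] by (auto simp: J_def)
  show "u N \<in> borel_measurable (I \<Otimes>\<^sub>M M)"
    unfolding u_def J_def[symmetric]
    by (intro borel_measurable_sum borel_measurable_times borel_measurable_const
      measurable_compose[OF measurable_fst \<phi>_measurable] measurable_compose[OF measurable_snd \<xi>_measurable] J)
  have eq: "(u N p)\<^sup>2 = (\<Sum>i\<in>J. \<Sum>j\<in>J. sqrt (\<nu> i) * sqrt (\<nu> j) * ((\<phi> i (fst p) * \<phi> j (fst p)) * (\<xi> i (snd p) * \<xi> j (snd p))))" for p
    by (simp add: u_def J_def power2_eq_square sum_product mult_ac)
  note pm = IM.integrable_product_mult[OF \<phi>_mult_integrable \<xi>_mult_integrable]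
  show "integrable (I \<Otimes>\<^sub>M M) (\<lambda>p. (u N p)\<^sup>2)"
    unfolding eq by (intro Bochner_Integration.integrable_sum integrable_mult_right pm(1) J)
  have "(\<integral>p. (u N p)\<^sup>2 \<partial>(I \<Otimes>\<^sub>M M)) = (\<Sum>i\<in>J. \<Sum>j\<in>J. sqrt (\<nu> i) * sqrt (\<nu> j) * (if i = j then 1 else 0))"
    unfolding eq using J by (simp add: pm \<phi>_orthonormal \<xi>_orthonormal) (auto intro!: sum.cong)
  also have "\<dots> = (\<Sum>j\<in>J. \<nu> j)"
    using J \<nu>_pos by (auto intro!: sum.cong simp: if_distrib sum.delta less_imp_le cong: if_cong)
  finally show "(\<integral>p. (u N p)\<^sup>2 \<partial>(I \<Otimes>\<^sub>M M)) = (\<Sum>j\<in>KL_idx n N. \<nu> j)" by (simp add: J_def)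
qed

text \<open>Up to sign this is the remainder of the expansion, now expressed through the truncation
  \<open>S\<close> that occurs in the approximations.\<close>

lemma remainder_square:
  shows "integrable (I \<Otimes>\<^sub>M M) (\<lambda>p. (S N (fst p) (\<lambda>j. \<xi> j (snd p)) - a (fst p) (snd p))\<^sup>2)"
    and "(\<lambda>N. \<integral>p. (S N (fst p) (\<lambda>j. \<xi> j (snd p)) - a (fst p) (snd p))\<^sup>2 \<partial>(I \<Otimes>\<^sub>M M)) \<longlonglongrightarrow> 0"
proof -
  have eq: "(S N (fst p) (\<lambda>j. \<xi> j (snd p)) - a (fst p) (snd p))\<^sup>2 =
    (a (fst p) (snd p) - \<mu> (fst p) - (\<Sum>j\<in>KL_idx n N. sqrt (\<nu> j) * \<phi> j (fst p) * \<xi> j (snd p)))\<^sup>2" for N p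
    unfolding S_fun_def by (subst power2_commute) (simp add: algebra_simps)
  have "(\<lambda>p. a (fst p) (snd p) - \<mu> (fst p)) \<in> borel_measurable (I \<Otimes>\<^sub>M M)"
    using a_measurable' measurable_compose[OF measurable_fst mean_measurable] by (intro borel_measurable_diff)
  then show "integrable (I \<Otimes>\<^sub>M M) (\<lambda>p. (S N (fst p) (\<lambda>j. \<xi> j (snd p)) - a (fst p) (snd p))\<^sup>2)"
    unfolding eq by (intro integrable_power2_diff centered_square_integrable partial_sum_square)
  show "(\<lambda>N. \<integral>p. (S N (fst p) (\<lambda>j. \<xi> j (snd p)) - a (fst p) (snd p))\<^sup>2 \<partial>(I \<Otimes>\<^sub>M M)) \<longlonglongrightarrow> 0"
    unfolding eq using KL by (simp add: KL_expansion_def)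
qed

text \<open>A partial sum of eigenvalues is the squared norm of a partial sum of the expansion. That
  partial sum is the centered process plus a remainder, and the remainders stay bounded in norm
  because they converge to zero.\<close>

lemma \<nu>_sum_bounded: "\<exists>V. \<forall>N. (\<Sum>j\<in>KL_idx n N. \<nu> j) \<le> V"
proof -
  let ?r = "\<lambda>N. \<integral>p. (S N (fst p) (\<lambda>j. \<xi> j (snd p)) - a (fst p) (snd p))\<^sup>2 \<partial>(I \<Otimes>\<^sub>M M)"
  let ?v = "\<integral>p. (a (fst p) (snd p) - \<mu> (fst p))\<^sup>2 \<partial>(I \<Otimes>\<^sub>M M)"
  obtain b where b: "\<And>N. \<bar>?r N\<bar> \<le> b"
    using convergent_imp_Bseq[OF convergentI[OF remainder_square(2)]] by (auto simp: Bseq_def)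
  have "(\<Sum>j\<in>KL_idx n N. \<nu> j) \<le> 2 * ?v + 2 * b" for N
  proof -
    let ?u = "\<lambda>p. (\<Sum>j\<in>KL_idx n N. sqrt (\<nu> j) * \<phi> j (fst p) * \<xi> j (snd p))"
    have "(\<Sum>j\<in>KL_idx n N. \<nu> j) = (\<integral>p. (?u p)\<^sup>2 \<partial>(I \<Otimes>\<^sub>M M))"
      by (simp add: partial_sum_square)
    also have "\<dots> \<le> (\<integral>p. 2 * (a (fst p) (snd p) - \<mu> (fst p))\<^sup>2
       + 2 * (S N (fst p) (\<lambda>j. \<xi> j (snd p)) - a (fst p) (snd p))\<^sup>2 \<partial>(I \<Otimes>\<^sub>M M))"
    proof (rule integral_mono)
      fix p
      have "(x + y)\<^sup>2 \<le> 2 * x\<^sup>2 + 2 * y\<^sup>2" for x y :: real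
        using sum_squares_bound[of x y] by (simp add: power2_sum)
      from this[of "a (fst p) (snd p) - \<mu> (fst p)" "S N (fst p) (\<lambda>j. \<xi> j (snd p)) - a (fst p) (snd p)"]
      show "(?u p)\<^sup>2 \<le> 2 * (a (fst p) (snd p) - \<mu> (fst p))\<^sup>2
         + 2 * (S N (fst p) (\<lambda>j. \<xi> j (snd p)) - a (fst p) (snd p))\<^sup>2"
        by (simp add: S_fun_def)
    qed (use partial_sum_square centered_square_integrable remainder_square in auto)
    also have "\<dots> = 2 * ?v + 2 * ?r N"
      using centered_square_integrable remainder_square(1) by simp
    also have "\<dots> \<le> 2 * ?v + 2 * b" using b[of N] by simp
    finally show ?thesis .
  qed
  then show ?thesis by blast
qed

text \<open>With \<open>c j\<close> the integral of \<open>\<phi> j\<close> over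
  \<open>{t0..s}\<close>, each coefficient satisfies \<open>sqrt (\<nu> j) * \<bar>c j\<bar> \<le>
  \<nu> j + (c j)\<^sup>2\<close>. The first summand is controlled by the eigenvalue sum and the
  second by Bessel's inequality, both uniformly in \<open>N\<close> and \<open>s\<close>.\<close>

lemma K_bounded:
  assumes A: "0 \<le> A"
  obtains C where "\<And>N s z. s \<in> {t0..T} \<Longrightarrow> (\<And>j. j \<in> KL_idx n N \<Longrightarrow> \<bar>z j\<bar> \<le> A) \<Longrightarrow> \<bar>K N s z\<bar> \<le> C"
proof -
  obtain V where V: "\<And>N. (\<Sum>j\<in>KL_idx n N. \<nu> j) \<le> V" using \<nu>_sum_bounded by blast
  have "\<bar>K N s z\<bar> \<le> (\<integral>r. \<bar>\<mu> r\<bar> \<partial>I) + (V + (T - t0)) * A"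
    if s: "s \<in> {t0..T}" and z: "\<And>j. j \<in> KL_idx n N \<Longrightarrow> \<bar>z j\<bar> \<le> A" for N s z
  proof -
    define c where "c j = (\<integral>r. indicator {t0..s} r * \<phi> j r \<partial>I)" for j
    have "\<bar>\<integral>r. indicator {t0..s} r * \<mu> r \<partial>I\<bar> \<le> (\<integral>r. \<bar>\<mu> r\<bar> \<partial>I)"
      by (rule integral_indicator_Icc_bound[OF mean_integrable])
    moreover have "\<bar>\<Sum>j\<in>KL_idx n N. sqrt (\<nu> j) * c j * z j\<bar> \<le> (\<Sum>j\<in>KL_idx n N. (\<nu> j + (c j)\<^sup>2) * A)"
    proof (rule sum_abs[THEN order_trans], rule sum_mono)
      fix j assume j: "j \<in> KL_idx n N"
      then have \<nu>: "0 < \<nu> j" using \<nu>_pos KL_idx_subset by blast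
      have "2 * sqrt (\<nu> j) * \<bar>c j\<bar> \<le> (sqrt (\<nu> j))\<^sup>2 + \<bar>c j\<bar>\<^sup>2" by (rule sum_squares_bound)
      moreover have "0 \<le> sqrt (\<nu> j) * \<bar>c j\<bar>" using \<nu> by simp
      moreover have "(sqrt (\<nu> j))\<^sup>2 = \<nu> j" using \<nu> by simp
      ultimately have "sqrt (\<nu> j) * \<bar>c j\<bar> \<le> \<nu> j + (c j)\<^sup>2" unfolding power2_abs by linarith
      then show "\<bar>sqrt (\<nu> j) * c j * z j\<bar> \<le> (\<nu> j + (c j)\<^sup>2) * A"
        using z[OF j] \<nu> by (simp add: abs_mult mult_mono)
    qed
    moreover have "(\<Sum>j\<in>KL_idx n N. (\<nu> j + (c j)\<^sup>2) * A) \<le> (V + (T - t0)) * A"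
      unfolding sum_distrib_right[symmetric] sum.distrib
      using V[of N] Bessel_indicator[OF s, of N] A by (intro mult_right_mono add_mono) (auto simp: c_def)
    ultimately show ?thesis
      unfolding K_expand[OF s] by (simp flip: c_def)
  qed
  then show ?thesis using that by blast
qed

lemma AE_a_integrable: "AE \<omega> in M. integrable I (\<lambda>s. a s \<omega>)"
proof -
  have "integrable (I \<Otimes>\<^sub>M M) (\<lambda>p. a (fst p) (snd p))"
    by (rule IM.square_integrable_imp_integrable[OF a_measurable' a_square_integrable])
  then show ?thesis
    using IM.AE_integrable_snd[of "\<lambda>s \<omega>. a s \<omega>"] by (simp add: case_prod_unfold)
qed

text \<open>L2 convergence on the product space implies L1 convergence there, which Fubini's theorem
  reads as convergence in mean of the pathwise L1 distances. From this an almost surely convergent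
  subsequence can be extracted.\<close>

lemma remainder_L1:
  shows "integrable M (\<lambda>\<omega>. \<integral>s. \<bar>S N s (\<lambda>j. \<xi> j \<omega>) - a s \<omega>\<bar> \<partial>I)"
    and "(\<lambda>N. \<integral>\<omega>. (\<integral>s. \<bar>S N s (\<lambda>j. \<xi> j \<omega>) - a s \<omega>\<bar> \<partial>I) \<partial>M) \<longlonglongrightarrow> 0"
proof -
  let ?d = "\<lambda>N p. S N (fst p) (\<lambda>j. \<xi> j (snd p)) - a (fst p) (snd p)"
  have m: "?d N \<in> borel_measurable (I \<Otimes>\<^sub>M M)" for N
  proof (intro borel_measurable_diff S_measurable)
    show "\<xi> j \<in> borel_measurable M" if "j \<in> KL_idx n N" for j
      using that KL_idx_subset \<xi>_measurable by blast
    show "(\<lambda>p. a (fst p) (snd p)) \<in> borel_measurable (I \<Otimes>\<^sub>M M)"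
      by (rule a_measurable')
  qed
  have i: "integrable (I \<Otimes>\<^sub>M M) (\<lambda>p. \<bar>?d N p\<bar>)" for N
    by (rule integrable_abs[OF IM.square_integrable_imp_integrable[OF m remainder_square(1)]])
  show "integrable M (\<lambda>\<omega>. \<integral>s. \<bar>S N s (\<lambda>j. \<xi> j \<omega>) - a s \<omega>\<bar> \<partial>I)"
    using IM.integrable_snd[of "\<lambda>s \<omega>. \<bar>S N s (\<lambda>j. \<xi> j \<omega>) - a s \<omega>\<bar>"] i by (simp add: case_prod_unfold)
  have "(\<integral>\<omega>. (\<integral>s. \<bar>S N s (\<lambda>j. \<xi> j \<omega>) - a s \<omega>\<bar> \<partial>I) \<partial>M) = (\<integral>p. \<bar>?d N p\<bar> \<partial>(I \<Otimes>\<^sub>M M))" for N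
    using IM.integral_snd[of "\<lambda>s \<omega>. \<bar>S N s (\<lambda>j. \<xi> j \<omega>) - a s \<omega>\<bar>"] i by (simp add: case_prod_unfold)
  then show "(\<lambda>N. \<integral>\<omega>. (\<integral>s. \<bar>S N s (\<lambda>j. \<xi> j \<omega>) - a s \<omega>\<bar> \<partial>I) \<partial>M) \<longlonglongrightarrow> 0"
    using IM.L2_imp_L1_tendsto_0[OF m remainder_square] by simp
qed

end

text \<open>Coefficients outside the index set do not enter, so random coefficients may be replaced
  by the restricted vectors that live in the product spaces.\<close>

lemma S_fun_cong: "(\<And>j. j \<in> KL_idx n N \<Longrightarrow> z j = z' j) \<Longrightarrow> S_fun \<mu> n \<nu> \<phi> N s z = S_fun \<mu> n \<nu> \<phi> N s z'"
  unfolding S_fun_def by (intro arg_cong2[where f="(+)"] sum.cong) auto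

lemma K_fun_cong: "(\<And>j. j \<in> KL_idx n N \<Longrightarrow> z j = z' j) \<Longrightarrow> K_fun t0 \<mu> n \<nu> \<phi> N s z = K_fun t0 \<mu> n \<nu> \<phi> N s z'"
  using S_fun_cong[of n N z z' \<mu> \<nu> \<phi>] unfolding K_fun_def S_fun_def by simp

section \<open>Measurability and integrability with the truncated exponent\<close>

context KL
begin

lemma K_eq_primitive: "s \<in> {t0..T} \<Longrightarrow> K N s z = primitive t0 T (\<lambda>r. S N r z) s"
  by (simp add: K_eq primitive_def)

lemma K_measurable:
  assumes z: "\<And>j. j \<in> KL_idx n N \<Longrightarrow> (\<lambda>x. z x j) \<in> borel_measurable X"
  shows "(\<lambda>p. K N (fst p) (z (snd p))) \<in> borel_measurable (I \<Otimes>\<^sub>M X)"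
proof -
  have "(\<lambda>p. \<integral>r. indicator {t0..fst p} r * S N r (z (snd p)) \<partial>I) \<in> borel_measurable (I \<Otimes>\<^sub>M X)"
    by (rule measurable_integral_indicator[OF S_measurable[OF z]]) measurable
  then show ?thesis
    by (rule measurable_cong[THEN iffD1, rotated]) (simp add: K_eq space_pair_measure mem_Times_iff)
qed

lemma K_measurable2:
  assumes z: "\<And>j. j \<in> KL_idx n N \<Longrightarrow> (\<lambda>x. z x j) \<in> borel_measurable X" and s: "s \<in> {t0..T}"
  shows "(\<lambda>x. K N s (z x)) \<in> borel_measurable X"
  using measurable_compose[OF measurable_Pair1'[of s I X] K_measurable[OF z]] s by simp

lemma K_measurable1: "(\<lambda>s. K N s z) \<in> borel_measurable I"
  using primitive_measurable[OF S_integrable]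
  by (rule measurable_cong[THEN iffD1, rotated]) (simp add: K_eq_primitive)

text \<open>For fixed coefficients of any size the exponent is a primitive of an integrable
  function, hence bounded on \<open>[t0, T]\<close>.\<close>

lemma integrable_mult_exp_K: "integrable I f \<Longrightarrow> integrable I (\<lambda>s. f s * exp (- K N s z))"
  by (rule integrable_mult_exp_bounded[OF _ K_measurable1])
    (auto simp: K_eq_primitive intro!: primitive_bound S_integrable)

lemma integral_exp_K_measurable:
  assumes f: "(\<lambda>p. f (fst p) (snd p)) \<in> borel_measurable (I \<Otimes>\<^sub>M X)"
    and z: "\<And>j. j \<in> KL_idx n N \<Longrightarrow> (\<lambda>x. z x j) \<in> borel_measurable X"
  shows "(\<lambda>x. \<integral>s. indicator {u..v} s * (f s x * exp (- K N s (z x))) \<partial>I) \<in> borel_measurable X"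
  by (rule measurable_integral_indicator[where X=X and z="\<lambda>x. x" and f="\<lambda>s x. f s x * exp (- K N s (z x))"])
    (auto intro!: borel_measurable_times f borel_measurable_exp borel_measurable_uminus K_measurable z
      intro: measurable_compose[OF _ borel_measurable_exp])

end

text \<open>The factored form of the solution is available only on integrable paths, so
  measurability is taken from the defining formula, through the inner integral first and then the
  outer one.\<close>

lemma sol_proc_measurable:
  assumes "KL M t0 T a na \<nu> \<phi> \<xi>" "KL M t0 T b nb \<gamma> \<psi> \<eta>" and t: "t0 \<le> t" "t \<le> T"
    and [measurable]: "x0 \<in> borel_measurable M"
  shows "sol_proc t0 x0 a b t \<in> borel_measurable M"
proof -
  interpret A: KL M t0 T a na \<nu> \<phi> \<xi> by fact
  interpret B: KL M t0 T b nb \<gamma> \<psi> \<eta> by fact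
  have eq: "sol_proc t0 x0 a b t \<omega> = x0 \<omega> * exp (\<integral>r. indicator {t0..t} r * a r \<omega> \<partial>A.I)
      + (\<integral>s. indicator {t0..t} s * (b s \<omega> * exp (\<integral>r. indicator {s..t} r * a r \<omega> \<partial>A.I)) \<partial>A.I)" for \<omega>
    unfolding sol_proc_def using t
    by (subst (1 2) set_integral_eq_restrict_space[of t0 _ _ T])
      (auto intro!: Bochner_Integration.integral_cong simp: set_integral_eq_restrict_space[of t0 _ _ T] split: split_indicator)
  have [measurable]: "(\<lambda>\<omega>. \<integral>r. indicator {t0..t} r * a r \<omega> \<partial>A.I) \<in> borel_measurable M"
    by (rule measurable_integral_indicator[OF A.a_measurable']) measurable
  have [measurable]: "(\<lambda>p. \<integral>r. indicator {fst p..t} r * a r (snd p) \<partial>A.I) \<in> borel_measurable (A.I \<Otimes>\<^sub>M M)"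
    by (rule measurable_integral_indicator[OF A.a_measurable']) measurable
  have [measurable]: "(\<lambda>p. b (fst p) (snd p) * exp (\<integral>r. indicator {fst p..t} r * a r (snd p) \<partial>A.I)) \<in> borel_measurable (A.I \<Otimes>\<^sub>M M)"
    by (intro borel_measurable_times B.a_measurable') measurable
  have [measurable]: "(\<lambda>\<omega>. \<integral>s. indicator {t0..t} s * (b s \<omega> * exp (\<integral>r. indicator {s..t} r * a r \<omega> \<partial>A.I)) \<partial>A.I) \<in> borel_measurable M"
    by (rule measurable_integral_indicator[where z="\<lambda>x. x" and X=M]) measurable
  show ?thesis unfolding eq by measurable
qed

section \<open>Convergence of the truncated densities\<close>

text \<open>An instance of \<open>affine_indep_density\<close> in which \<open>Z\<close> collects
  all coefficients except \<open>\<eta> 1\<close>: the truncated solution is affine in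
  \<open>\<eta> 1\<close> with slope \<open>exp (k \<omega> t) * D \<omega>\<close>, the reciprocal
  of \<open>W \<omega>\<close>. The joint density \<open>fJ\<close> first turns the approximation
  into an expectation.\<close>

lemma truncated_density:
  fixes M :: "'w measure" and f0 f :: "real \<Rightarrow> real" and fJ :: "(nat \<Rightarrow> real) \<times> (nat \<Rightarrow> real) \<Rightarrow> real"
  assumes KLa: "KL M t0 T a na \<nu> \<phi> \<xi>" and KLb: "KL M t0 T b nb \<gamma> \<psi> \<eta>"
    and t: "t0 < t" "t \<le> T" and N1: "1 \<in> KL_idx nb N"
    and \<psi>1: "\<And>s. s \<in> {t0<..<T} \<Longrightarrow> 0 < \<psi> 1 s"
    and f0: "\<And>x. 0 \<le> f0 x" "distributed M lborel x0 (\<lambda>x. ennreal (f0 x))"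
    and f: "\<And>x. 0 \<le> f x" "distributed M lborel (\<eta> 1) (\<lambda>x. ennreal (f x))"
    and ind: "indep3 M lborel x0 lborel (\<eta> 1)
          (KL_space na N \<Otimes>\<^sub>M PiM (KL_idx nb N - {1}) (\<lambda>_. lborel))
          (\<lambda>\<omega>. (restrict (\<lambda>j. \<xi> j \<omega>) (KL_idx na N), restrict (\<lambda>i. \<eta> i \<omega>) (KL_idx nb N - {1})))"
    and fJ: "\<And>p. 0 \<le> fJ p" "distributed M (KL_space na N \<Otimes>\<^sub>M KL_space nb N)
          (\<lambda>\<omega>. (restrict (\<lambda>j. \<xi> j \<omega>) (KL_idx na N), restrict (\<lambda>i. \<eta> i \<omega>) (KL_idx nb N)))
          (\<lambda>p. ennreal (fJ p))"
  defines "k \<equiv> \<lambda>\<omega> s. K_fun t0 (mean_fun M a) na \<nu> \<phi> N s (\<lambda>j. \<xi> j \<omega>)"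
  defines "D \<equiv> \<lambda>\<omega>. \<integral>s. indicator {t0..t} s * (sqrt (\<gamma> 1) * \<psi> 1 s * exp (- k \<omega> s)) \<partial>restrict_space lborel {t0..T}"
  defines "X \<equiv> \<lambda>\<omega>. exp (k \<omega> t) * (x0 \<omega> + (\<integral>s. indicator {t0..t} s *
      (S_fun (mean_fun M b) nb \<gamma> \<psi> N s (\<lambda>i. \<eta> i \<omega>) * exp (- k \<omega> s)) \<partial>restrict_space lborel {t0..T}))"
  defines "W \<equiv> \<lambda>\<omega>. exp (- k \<omega> t) / D \<omega>"
  shows "X \<in> borel_measurable M" "W \<in> borel_measurable M" "\<And>\<omega>. 0 < D \<omega>"
    and "f1_approx t0 f0 fJ (mean_fun M a) na \<nu> \<phi> (mean_fun M b) nb \<gamma> \<psi> N x t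
        = (\<integral>\<omega>. f (\<eta> 1 \<omega> + (x - X \<omega>) * W \<omega>) * W \<omega> \<partial>M)"
    and "distributed M lborel X (\<lambda>x. \<integral>\<^sup>+\<omega>. ennreal (f (\<eta> 1 \<omega> + (x - X \<omega>) * W \<omega>) * W \<omega>) \<partial>M)"
proof -
  interpret A: KL M t0 T a na \<nu> \<phi> \<xi> by fact
  interpret B: KL M t0 T b nb \<gamma> \<psi> \<eta> by fact
  have all1: "1 \<in> KL_all nb" using N1 KL_idx_subset by blast
  have tT: "t \<in> {t0..T}" using t by simp
  let ?Mc = "KL_space na N \<Otimes>\<^sub>M PiM (KL_idx nb N - {1}) (\<lambda>_. lborel :: real measure)"
  let ?MJ = "KL_space na N \<Otimes>\<^sub>M KL_space nb N"
  let ?Z = "\<lambda>\<omega>. (restrict (\<lambda>j. \<xi> j \<omega>) (KL_idx na N), restrict (\<lambda>i. \<eta> i \<omega>) (KL_idx nb N - {1}))"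
  let ?J = "\<lambda>\<omega>. (restrict (\<lambda>j. \<xi> j \<omega>) (KL_idx na N), restrict (\<lambda>i. \<eta> i \<omega>) (KL_idx nb N))"
  \<comment> \<open>The exponent at \<open>t\<close>, the coefficient of \<open>\<eta> 1\<close>,
    the offset and the full integral, as functions of deterministic coefficient vectors.\<close>
  define \<kappa> where "\<kappa> p = A.K N t (fst p)" for p :: "(nat \<Rightarrow> real) \<times> (nat \<Rightarrow> real)"
  define d where "d p = (\<integral>s. indicator {t0..t} s * (sqrt (\<gamma> 1) * \<psi> 1 s * exp (- A.K N s (fst p))) \<partial>A.I)"
    for p :: "(nat \<Rightarrow> real) \<times> (nat \<Rightarrow> real)"
  \<comment> \<open>Overwriting coordinate 1 by 0 makes \<open>q\<close> take the same value on
    \<open>?Z\<close>, where this coordinate is undefined, and on \<open>?J\<close>, where it is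
    \<open>\<eta> 1\<close>.\<close>
  define q where "q p = (\<integral>s. indicator {t0..t} s * (B.S N s ((snd p)(1 := 0)) * exp (- A.K N s (fst p))) \<partial>A.I)"
    for p :: "(nat \<Rightarrow> real) \<times> (nat \<Rightarrow> real)"
  define Q where "Q p = (\<integral>s. indicator {t0..t} s * (B.S N s (snd p) * exp (- A.K N s (fst p))) \<partial>A.I)"
    for p :: "(nat \<Rightarrow> real) \<times> (nat \<Rightarrow> real)"
  have c1: "(\<lambda>p. fst p j) \<in> borel_measurable (KL_space na N \<Otimes>\<^sub>M R)"
    if "j \<in> KL_idx na N" for j and R :: "'z measure"
    using that unfolding KL_space_def by measurable
  have c2: "(\<lambda>p. snd p j) \<in> borel_measurable ?MJ" if "j \<in> KL_idx nb N" for j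
    using that unfolding KL_space_def by measurable
  have c3: "(\<lambda>p. ((snd p)(1 := 0)) j) \<in> borel_measurable ?Mc" if "j \<in> KL_idx nb N" for j
  proof (cases "j = 1")
    case False
    with that have j: "j \<in> KL_idx nb N - {1}" by simp
    then have "(\<lambda>p. snd p j) \<in> borel_measurable ?Mc" by measurable
    with False show ?thesis by simp
  qed simp
  have \<psi>m: "(\<lambda>p. sqrt (\<gamma> 1) * \<psi> 1 (fst p)) \<in> borel_measurable (A.I \<Otimes>\<^sub>M R)" for R :: "'z measure"
    by (intro borel_measurable_times borel_measurable_const measurable_compose[OF measurable_fst B.\<phi>_measurable] all1)
  \<comment> \<open>Only the first component enters, so the second factor \<open>R\<close> is left
    open; \<open>\<kappa>\<close> is used over both \<open>?Mc\<close> and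
    \<open>?MJ\<close>.\<close>
  have m\<kappa>: "\<kappa> \<in> borel_measurable (KL_space na N \<Otimes>\<^sub>M R)" for R
    unfolding \<kappa>_def by (rule A.K_measurable2[OF c1 tT])
  have md: "d \<in> borel_measurable (KL_space na N \<Otimes>\<^sub>M R)" for R
    unfolding d_def by (rule A.integral_exp_K_measurable[OF \<psi>m c1])
  have mq: "q \<in> borel_measurable ?Mc"
    unfolding q_def by (rule A.integral_exp_K_measurable[OF B.S_measurable[OF c3] c1])
  have mQ[measurable]: "Q \<in> borel_measurable ?MJ"
    unfolding Q_def by (rule A.integral_exp_K_measurable[OF B.S_measurable[OF c2] c1])
  have i\<psi>: "integrable A.I (\<lambda>s. sqrt (\<gamma> 1) * \<psi> 1 s * exp (- A.K N s z))" for z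
    by (intro A.integrable_mult_exp_K integrable_mult_right B.\<phi>_integrable all1)
  have \<gamma>1: "0 < \<gamma> 1" using B.\<nu>_pos all1 .
  \<comment> \<open>Positivity holds for every coefficient vector, so the division by
    \<open>D\<close> is legitimate everywhere and not only almost surely.\<close>
  have dpos: "0 < d p" for p
    unfolding d_def using t \<psi>1 \<gamma>1 by (intro integral_indicator_Icc_pos i\<psi>) auto
  have Qqd: "Q p = q p + d p * snd p 1" for p
  proof -
    have S: "B.S N s (snd p) = B.S N s ((snd p)(1 := 0)) + sqrt (\<gamma> 1) * \<psi> 1 s * snd p 1" for s
      using N1 by (simp add: S_fun_def sum.remove[OF finite_KL_idx N1] fun_upd_def cong: sum.cong_simp)
    have "Q p = (\<integral>s. indicator {t0..t} s * (B.S N s ((snd p)(1 := 0)) * exp (- A.K N s (fst p)))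
       + indicator {t0..t} s * (sqrt (\<gamma> 1) * \<psi> 1 s * exp (- A.K N s (fst p))) * snd p 1 \<partial>A.I)"
      unfolding Q_def S by (intro Bochner_Integration.integral_cong) (auto simp: algebra_simps)
    also have "\<dots> = q p + (\<integral>s. indicator {t0..t} s * (sqrt (\<gamma> 1) * \<psi> 1 s * exp (- A.K N s (fst p))) * snd p 1 \<partial>A.I)"
      unfolding q_def
      by (intro Bochner_Integration.integral_add integrable_mult_left integrable_indicator_Icc_mult i\<psi>
          A.integrable_mult_exp_K B.S_integrable)
    finally show ?thesis by (simp add: d_def)
  qed
  have kZ: "A.K N s (restrict (\<lambda>j. \<xi> j \<omega>) (KL_idx na N)) = k \<omega> s" for \<omega> s
    unfolding k_def by (rule K_fun_cong) simp
  have \<kappa>Z: "\<kappa> (?Z \<omega>) = k \<omega> t" "\<kappa> (?J \<omega>) = k \<omega> t" and dZ: "d (?Z \<omega>) = D \<omega>" "d (?J \<omega>) = D \<omega>" for \<omega>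
    by (simp_all add: \<kappa>_def d_def D_def kZ)
  have QJ: "Q (?J \<omega>) = (\<integral>s. indicator {t0..t} s *
      (B.S N s (\<lambda>i. \<eta> i \<omega>) * exp (- k \<omega> s)) \<partial>A.I)" for \<omega>
  proof -
    have "B.S N s (restrict (\<lambda>i. \<eta> i \<omega>) (KL_idx nb N)) = B.S N s (\<lambda>i. \<eta> i \<omega>)" for s
      by (rule S_fun_cong) simp
    then show ?thesis by (simp add: Q_def kZ)
  qed
  have qZ: "q (?Z \<omega>) = q (?J \<omega>)" for \<omega>
  proof -
    have "B.S N s ((restrict (\<lambda>i. \<eta> i \<omega>) (KL_idx nb N - {1}))(1 := 0)) = B.S N s ((restrict (\<lambda>i. \<eta> i \<omega>) (KL_idx nb N))(1 := 0))" for s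
      by (rule S_fun_cong) simp
    then show ?thesis by (simp add: q_def)
  qed
  have qd: "q (?Z \<omega>) + d (?Z \<omega>) * \<eta> 1 \<omega> = Q (?J \<omega>)" for \<omega>
    using N1 by (simp only: qZ Qqd dZ) simp
  have X: "X = (\<lambda>\<omega>. exp (\<kappa> (?Z \<omega>)) * (x0 \<omega> + q (?Z \<omega>) + d (?Z \<omega>) * \<eta> 1 \<omega>))"
    unfolding add.assoc qd QJ by (simp only: X_def \<kappa>Z)
  have W: "W = (\<lambda>\<omega>. exp (- \<kappa> (?Z \<omega>)) / d (?Z \<omega>))"
    by (simp only: W_def \<kappa>Z dZ)
  show Dpos: "0 < D \<omega>" for \<omega> using dpos[of "?Z \<omega>"] by (simp only: dZ)
  note dens = affine_indep_density[OF A.prob_space_axioms f0 f ind m\<kappa> mq md dpos]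
  show "distributed M lborel X (\<lambda>x. \<integral>\<^sup>+\<omega>. ennreal (f (\<eta> 1 \<omega> + (x - X \<omega>) * W \<omega>) * W \<omega>) \<partial>M)"
    unfolding X W by (rule dens(2))
  then show [measurable]: "X \<in> borel_measurable M" by (simp add: distributed_def)
  have Zm: "?Z \<in> measurable M ?Mc" using ind by (simp add: indep3_def)
  show [measurable]: "W \<in> borel_measurable M"
    unfolding W by (intro borel_measurable_divide measurable_compose[OF Zm md]
      measurable_compose[OF _ borel_measurable_exp] borel_measurable_uminus measurable_compose[OF Zm m\<kappa>])
  have [measurable]: "\<eta> 1 \<in> borel_measurable M" using f(2) by (simp add: distributed_def)
  have [measurable]: "f \<in> borel_measurable borel" "f0 \<in> borel_measurable borel"
    using distributed_real_measurable[OF _ f(2)] f(1) distributed_real_measurable[OF _ f0(2)] f0(1) by simp_all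
  have [measurable]: "\<kappa> \<in> borel_measurable ?MJ" by (rule m\<kappa>)
  have Jm[measurable]: "?J \<in> measurable M ?MJ" using fJ(2) by (simp add: distributed_def)
  define h where "h p = f0 (x * exp (- \<kappa> p) - Q p) * exp (- \<kappa> p)" for p
  have hm[measurable]: "h \<in> borel_measurable ?MJ" unfolding h_def by measurable
  have "f1_approx t0 f0 fJ (mean_fun M a) na \<nu> \<phi> (mean_fun M b) nb \<gamma> \<psi> N x t = (\<integral>p. fJ p * h p \<partial>?MJ)"
    unfolding f1_approx_def h_def \<kappa>_def Q_def
    using t by (subst set_integral_eq_restrict_space[of t0 _ _ T]) (simp_all add: mult_ac)
  also have "\<dots> = (\<integral>\<omega>. h (?J \<omega>) \<partial>M)"
    by (rule distributed_integral[OF fJ(2) hm fJ(1)])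
  \<comment> \<open>The exchange of densities is an identity between nonnegative integrals. The
    passage there and back is safe even for an infinite value, since \<open>enn2real\<close> and the
    Bochner integral both give 0 then.\<close>
  also have "\<dots> = enn2real (\<integral>\<^sup>+\<omega>. ennreal (h (?J \<omega>)) \<partial>M)"
    by (rule integral_eq_nn_integral) (auto simp: h_def f0 intro!: measurable_compose[OF Jm hm])
  also have "(\<integral>\<^sup>+\<omega>. ennreal (h (?J \<omega>)) \<partial>M) = (\<integral>\<^sup>+\<omega>. ennreal (f (\<eta> 1 \<omega> + (x - X \<omega>) * W \<omega>) * W \<omega>) \<partial>M)"
    unfolding X W dens(1)[symmetric] qd by (simp only: h_def \<kappa>Z)
  also have "enn2real \<dots> = (\<integral>\<omega>. f (\<eta> 1 \<omega> + (x - X \<omega>) * W \<omega>) * W \<omega> \<partial>M)"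
  proof (rule integral_eq_nn_integral[symmetric])
    have "0 \<le> W \<omega>" for \<omega> using Dpos[of \<omega>] by (simp add: W_def)
    then show "AE \<omega> in M. 0 \<le> f (\<eta> 1 \<omega> + (x - X \<omega>) * W \<omega>) * W \<omega>" by (simp add: f)
  qed measurable
  finally show "f1_approx t0 f0 fJ (mean_fun M a) na \<nu> \<phi> (mean_fun M b) nb \<gamma> \<psi> N x t
        = (\<integral>\<omega>. f (\<eta> 1 \<omega> + (x - X \<omega>) * W \<omega>) * W \<omega> \<partial>M)" .
qed

section \<open>Pathwise limits and the density of the solution\<close>

theorem theorem9:
  fixes M :: "'w measure" and t0 T A :: real and x0 :: "'w \<Rightarrow> real"
    and a b :: "real \<Rightarrow> 'w \<Rightarrow> real"
    and na nb :: enat and \<nu> \<gamma> :: "nat \<Rightarrow> real" and \<phi> \<psi> :: "nat \<Rightarrow> real \<Rightarrow> real"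
    and \<xi> \<eta> :: "nat \<Rightarrow> 'w \<Rightarrow> real"
    and f0 f\<eta>1 :: "real \<Rightarrow> real"
    and fJ :: "nat \<Rightarrow> (nat \<Rightarrow> real) \<times> (nat \<Rightarrow> real) \<Rightarrow> real"
  assumes P: "prob_space M" and complete: "complete_measure M" and tT: "t0 < T"
    and KLa: "KL_expansion M t0 T a na \<nu> \<phi> \<xi>"
    and KLb: "KL_expansion M t0 T b nb \<gamma> \<psi> \<eta>" and nb1: "nb \<ge> 1"
    and H1: "L2_proc M t0 T a" "L2_proc M t0 T b"
    and f0: "\<forall>x. 0 \<le> f0 x" "distributed M lborel x0 (\<lambda>x. ennreal (f0 x))"
    and f\<eta>1: "\<forall>x. 0 \<le> f\<eta>1 x" "distributed M lborel (\<eta> 1) (\<lambda>x. ennreal (f\<eta>1 x))"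
    and H2_ac: "\<forall>N\<ge>1. absolutely_continuous
        (KL_space na N \<Otimes>\<^sub>M PiM (KL_idx nb N - {1}) (\<lambda>_. lborel))
        (distr M (KL_space na N \<Otimes>\<^sub>M PiM (KL_idx nb N - {1}) (\<lambda>_. lborel))
           (\<lambda>\<omega>. (restrict (\<lambda>j. \<xi> j \<omega>) (KL_idx na N),
                  restrict (\<lambda>i. \<eta> i \<omega>) (KL_idx nb N - {1}))))"
    and H2_indep: "\<forall>N\<ge>1. indep3 M lborel x0 lborel (\<eta> 1)
          (KL_space na N \<Otimes>\<^sub>M PiM (KL_idx nb N - {1}) (\<lambda>_. lborel))
          (\<lambda>\<omega>. (restrict (\<lambda>j. \<xi> j \<omega>) (KL_idx na N),
                  restrict (\<lambda>i. \<eta> i \<omega>) (KL_idx nb N - {1})))"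
    and fJ: "\<forall>N p. 0 \<le> fJ N p"
      "\<forall>N\<ge>1. distributed M (KL_space na N \<Otimes>\<^sub>M KL_space nb N)
          (\<lambda>\<omega>. (restrict (\<lambda>j. \<xi> j \<omega>) (KL_idx na N), restrict (\<lambda>i. \<eta> i \<omega>) (KL_idx nb N)))
          (\<lambda>p. ennreal (fJ N p))"
    and H3: "continuous_on UNIV f\<eta>1" "bounded (range f\<eta>1)"
    and H4: "0 < A" "\<forall>j\<in>KL_all na. AE \<omega> in M. \<xi> j \<omega> \<in> {-A..A}"
      "\<forall>t\<in>{t0<..<T}. 0 < \<psi> 1 t"
  shows "\<forall>t\<in>{t0<..T}. \<exists>f1t :: real \<Rightarrow> real.
           (\<forall>x. 0 \<le> f1t x) \<and>
           distributed M lborel (sol_proc t0 x0 a b t) (\<lambda>x. ennreal (f1t x)) \<and>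
           (\<forall>x. (\<lambda>N. f1_approx t0 f0 (fJ N) (mean_fun M a) na \<nu> \<phi> (mean_fun M b) nb \<gamma> \<psi> N x t)
                   \<longlonglongrightarrow> f1t x)"
proof
  fix t assume "t \<in> {t0<..T}"
  then have t: "t0 < t" "t \<le> T" "t0 \<le> t" "t \<in> {t0..T}" by auto
  interpret prob_space M by (rule P)
  interpret A: KL M t0 T a na \<nu> \<phi> \<xi> by (intro KL.intro KL_axioms.intro P tT KLa H1)
  interpret B: KL M t0 T b nb \<gamma> \<psi> \<eta> by (intro KL.intro KL_axioms.intro P tT KLb H1)
  \<comment> \<open>The truncation of order 0 contains no \<open>\<eta> 1\<close>, and (H2) starts
    at order 1. The sequences below are therefore indexed through \<open>Suc n\<close>; the shift is
    undone at the end.\<close>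
  have idx1: "1 \<in> KL_idx nb (Suc n)" for n
    using nb1 by (simp add: KL_idx_def one_enat_def)
  have all1: "1 \<in> KL_all nb" using idx1[of 0] KL_idx_subset by blast
  have \<gamma>1: "0 < \<gamma> 1" using B.\<nu>_pos all1 .
  define k where "k n \<omega> s = A.K (Suc n) s (\<lambda>j. \<xi> j \<omega>)" for n \<omega> s
  define D where "D n \<omega> = (\<integral>s. indicator {t0..t} s * (sqrt (\<gamma> 1) * \<psi> 1 s * exp (- k n \<omega> s)) \<partial>A.I)" for n \<omega>
  define X where "X n \<omega> = exp (k n \<omega> t) * (x0 \<omega> + (\<integral>s. indicator {t0..t} s *
      (B.S (Suc n) s (\<lambda>i. \<eta> i \<omega>) * exp (- k n \<omega> s)) \<partial>A.I))" for n \<omega>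
  define W where "W n \<omega> = exp (- k n \<omega> t) / D n \<omega>" for n \<omega>
  \<comment> \<open>The prospective limits of \<open>k\<close>, \<open>D\<close>, \<open>W\<close>
    and \<open>X\<close>, with the paths of \<open>a\<close> and \<open>b\<close> in place of the
    truncations.\<close>
  define ka where "ka \<omega> = primitive t0 T (\<lambda>s. a s \<omega>)" for \<omega>
  define Da where "Da \<omega> = (\<integral>s. indicator {t0..t} s * (sqrt (\<gamma> 1) * \<psi> 1 s * exp (- ka \<omega> s)) \<partial>A.I)" for \<omega>
  define Wa where "Wa \<omega> = exp (- ka \<omega> t) / Da \<omega>" for \<omega>
  define Xa where "Xa = sol_proc t0 x0 a b t"
  note tr = truncated_density[OF A.KL_axioms B.KL_axioms t(1,2) idx1 H4(3)[rule_format] f0(1)[rule_format] f0(2)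
      f\<eta>1(1)[rule_format] f\<eta>1(2) H2_indep[rule_format] fJ(1)[rule_format] fJ(2)[rule_format],
      folded k_def, folded D_def X_def, folded W_def]
  have approx: "f1_approx t0 f0 (fJ (Suc n)) (mean_fun M a) na \<nu> \<phi> (mean_fun M b) nb \<gamma> \<psi> (Suc n) x t
        = (\<integral>\<omega>. f\<eta>1 (\<eta> 1 \<omega> + (x - X n \<omega>) * W n \<omega>) * W n \<omega> \<partial>M)" for n x
    by (rule tr(4)) simp_all
  have Xm[measurable]: "X n \<in> borel_measurable M" and Wm[measurable]: "W n \<in> borel_measurable M"
    and Dpos: "0 < D n \<omega>" for n \<omega>
    by (rule tr(1) tr(2) tr(3); simp)+
  have ndens: "distributed M lborel (X n) (\<lambda>x. \<integral>\<^sup>+\<omega>. ennreal (f\<eta>1 (\<eta> 1 \<omega> + (x - X n \<omega>) * W n \<omega>) * W n \<omega>) \<partial>M)" for n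
    by (rule tr(5)) simp_all
  have \<eta>1m[measurable]: "\<eta> 1 \<in> borel_measurable M" and [measurable]: "x0 \<in> borel_measurable M"
    using f\<eta>1(2) f0(2) by (simp_all add: distributed_def)
  have fm[measurable]: "f\<eta>1 \<in> borel_measurable borel"
    using H3(1) by (rule borel_measurable_continuous_onI)
  have Xam[measurable]: "Xa \<in> borel_measurable M"
    unfolding Xa_def by (rule sol_proc_measurable[OF A.KL_axioms B.KL_axioms t(3,2)]) simp
  have \<psi>i: "integrable A.I (\<lambda>s. sqrt (\<gamma> 1) * \<psi> 1 s)"
    by (intro integrable_mult_right B.\<phi>_integrable all1)
  have \<psi>m[measurable]: "\<psi> 1 \<in> borel_measurable A.I" by (rule B.\<phi>_measurable[OF all1])
  have kam: "(\<lambda>p. ka (snd p) (fst p)) \<in> borel_measurable (A.I \<Otimes>\<^sub>M M)"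
    unfolding ka_def primitive_def by (rule measurable_integral_indicator[OF A.a_measurable']) measurable
  have katm[measurable]: "(\<lambda>\<omega>. ka \<omega> t) \<in> borel_measurable M"
    unfolding ka_def primitive_def by (rule measurable_integral_indicator[OF A.a_measurable']) measurable
  have [measurable]: "Da \<in> borel_measurable M"
    unfolding Da_def
    by (rule measurable_integral_indicator[where z="\<lambda>x. x" and X=M]) (use kam in measurable)
  have Wam[measurable]: "Wa \<in> borel_measurable M" unfolding Wa_def by measurable
  obtain C where C: "\<And>N s z. s \<in> {t0..T} \<Longrightarrow> (\<And>j. j \<in> KL_idx na N \<Longrightarrow> \<bar>z j\<bar> \<le> A) \<Longrightarrow> \<bar>A.K N s z\<bar> \<le> C"
    using A.K_bounded[of A] H4(1) by (metis less_imp_le)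
  have \<xi>A: "AE \<omega> in M. \<forall>j\<in>KL_all na. \<bar>\<xi> j \<omega>\<bar> \<le> A"
    using H4(2) by (subst AE_ball_countable) (auto simp: abs_le_iff elim!: eventually_mono)
  have kC: "\<bar>k n \<omega> s\<bar> \<le> C" if "\<forall>j\<in>KL_all na. \<bar>\<xi> j \<omega>\<bar> \<le> A" "s \<in> {t0..T}" for n \<omega> s
    unfolding k_def using that KL_idx_subset[of na "Suc n"] by (intro C) auto
  \<comment> \<open>The value of the integral \<open>D\<close> when the exponent is replaced by its
    largest possible value \<open>C\<close>: a deterministic positive lower bound.\<close>
  define d0 where "d0 = (\<integral>s. indicator {t0..t} s * (sqrt (\<gamma> 1) * \<psi> 1 s * exp (- C)) \<partial>A.I)"
  have d0i: "integrable A.I (\<lambda>s. sqrt (\<gamma> 1) * \<psi> 1 s * exp (- C))"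
    using \<psi>i by (rule integrable_mult_left)
  have d0: "0 < d0"
    unfolding d0_def using t H4(3) \<gamma>1 by (intro integral_indicator_Icc_pos d0i) auto
  have d0_le: "d0 \<le> (\<integral>s. indicator {t0..t} s * (sqrt (\<gamma> 1) * \<psi> 1 s * exp (- g s)) \<partial>A.I)"
    if g: "g \<in> borel_measurable A.I" "\<And>s. s \<in> {t0..T} \<Longrightarrow> \<bar>g s\<bar> \<le> C" for g
    unfolding d0_def
  proof (rule integral_mono_AE)
    \<comment> \<open>The sign of \<open>\<psi> 1\<close> is known only inside
      \<open>(t0, T)\<close>, so both endpoints are discarded as null sets; this covers the case
      \<open>t = T\<close>.\<close>
    show "AE s in A.I. indicator {t0..t} s * (sqrt (\<gamma> 1) * \<psi> 1 s * exp (- C))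
       \<le> indicator {t0..t} s * (sqrt (\<gamma> 1) * \<psi> 1 s * exp (- g s))"
      using AE_Icc_neq[of t0 t0 T] AE_Icc_neq[of T t0 T] AE_space
    proof eventually_elim
      case (elim s)
      then have "0 \<le> sqrt (\<gamma> 1) * \<psi> 1 s" "- C \<le> - g s"
        using H4(3) \<gamma>1 g(2)[of s] by (auto simp: less_imp_le abs_le_iff)
      then show ?case by (auto intro!: mult_left_mono split: split_indicator)
    qed
  qed (intro integrable_indicator_Icc_mult d0i integrable_mult_exp_bounded[OF \<psi>i g]; assumption)+
  \<comment> \<open>The numerator of \<open>W\<close> is at most \<open>exp C\<close> and its
    denominator at least \<open>d0\<close>.\<close>
  define c where "c = exp C / d0"
  have Wc: "AE \<omega> in M. 0 \<le> W n \<omega> \<and> W n \<omega> \<le> c" for n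
    using \<xi>A
  proof eventually_elim
    case (elim \<omega>)
    have "d0 \<le> D n \<omega>"
      unfolding D_def by (rule d0_le) (use A.K_measurable1 kC[OF elim] in \<open>auto simp: k_def\<close>)
    moreover have "exp (- k n \<omega> t) \<le> exp C" using kC[OF elim t(4), of n] by simp
    ultimately show ?case
      unfolding W_def c_def using d0 by (auto intro!: divide_nonneg_pos frac_le)
  qed
  obtain B where B: "\<And>x. f\<eta>1 x \<le> B"
    using H3(2) by (auto simp: bounded_iff abs_le_iff)
  have sub: "\<exists>s. strict_mono s \<and>
       (AE \<omega> in M. (\<lambda>n. X (r (s n)) \<omega>) \<longlonglongrightarrow> Xa \<omega> \<and> (\<lambda>n. W (r (s n)) \<omega>) \<longlonglongrightarrow> Wa \<omega>)"
    if r: "strict_mono r" for r :: "nat \<Rightarrow> nat"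
  proof -
    \<comment> \<open>Pathwise L1 errors of the two expansions. Both are nonnegative, and a
      subsequence along which their sum vanishes serves \<open>a\<close> and \<open>b\<close> at the
      same time.\<close>
    define ea where "ea N \<omega> = (\<integral>s. \<bar>A.S N s (\<lambda>j. \<xi> j \<omega>) - a s \<omega>\<bar> \<partial>A.I)" for N \<omega>
    define eb where "eb N \<omega> = (\<integral>s. \<bar>B.S N s (\<lambda>j. \<eta> j \<omega>) - b s \<omega>\<bar> \<partial>A.I)" for N \<omega>
    have e0: "0 \<le> ea N \<omega>" "0 \<le> eb N \<omega>" for N \<omega> by (simp_all add: ea_def eb_def)
    have ei: "integrable M (ea N)" "integrable M (eb N)" for N
      unfolding ea_def eb_def by (rule A.remainder_L1 B.remainder_L1)+
    have "(\<lambda>N. \<integral>\<omega>. norm (ea N \<omega> + eb N \<omega>) \<partial>M) = (\<lambda>N. (\<integral>\<omega>. ea N \<omega> \<partial>M) + (\<integral>\<omega>. eb N \<omega> \<partial>M))"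
      using ei e0 by simp
    also have "\<dots> \<longlonglongrightarrow> 0"
      using tendsto_add[OF A.remainder_L1(2) B.remainder_L1(2)] by (simp add: ea_def eb_def)
    finally have lim: "(\<lambda>N. \<integral>\<omega>. norm (ea N \<omega> + eb N \<omega>) \<partial>M) \<longlonglongrightarrow> 0" .
    have "strict_mono (\<lambda>n. Suc (r n))" using r by (auto simp: strict_mono_def)
    from LIMSEQ_subseq_LIMSEQ[OF lim this]
    have "(\<lambda>n. \<integral>\<omega>. norm (ea (Suc (r n)) \<omega> + eb (Suc (r n)) \<omega>) \<partial>M) \<longlonglongrightarrow> 0"
      by (simp add: o_def)
    then obtain s where s: "strict_mono s"
      "AE \<omega> in M. (\<lambda>n. ea (Suc (r (s n))) \<omega> + eb (Suc (r (s n))) \<omega>) \<longlonglongrightarrow> 0"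
      using tendsto_L1_AE_subseq[of M "\<lambda>n \<omega>. ea (Suc (r n)) \<omega> + eb (Suc (r n)) \<omega>"] ei by auto
    have "AE \<omega> in M. (\<lambda>n. X (r (s n)) \<omega>) \<longlonglongrightarrow> Xa \<omega> \<and> (\<lambda>n. W (r (s n)) \<omega>) \<longlonglongrightarrow> Wa \<omega>"
      using s(2) \<xi>A A.AE_a_integrable B.AE_a_integrable
    proof eventually_elim
      case (elim \<omega>)
      define aN where "aN n u = A.S (Suc (r (s n))) u (\<lambda>j. \<xi> j \<omega>)" for n u
      define bN where "bN n u = B.S (Suc (r (s n))) u (\<lambda>j. \<eta> j \<omega>)" for n u
      have aNi: "integrable A.I (aN n)" "integrable A.I (bN n)" for n
        unfolding aN_def bN_def by (rule A.S_integrable B.S_integrable)+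
      \<comment> \<open>Each error lies between 0 and the sum of the two.\<close>
      have alim: "(\<lambda>n. \<integral>u. \<bar>aN n u - a u \<omega>\<bar> \<partial>A.I) \<longlonglongrightarrow> 0"
        by (rule tendsto_sandwich[OF _ _ tendsto_const elim(1)])
          (use e0 in \<open>auto simp: ea_def aN_def\<close>)
      have blim: "(\<lambda>n. \<integral>u. \<bar>bN n u - b u \<omega>\<bar> \<partial>A.I) \<longlonglongrightarrow> 0"
        by (rule tendsto_sandwich[OF _ _ tendsto_const elim(1)])
          (use e0 in \<open>auto simp: eb_def bN_def\<close>)
      have kp: "k (r (s n)) \<omega> u = primitive t0 T (aN n) u" if "u \<in> {t0..T}" for n u
        using that by (simp add: k_def A.K_eq_primitive aN_def[abs_def])
      have pC: "\<bar>primitive t0 T (aN n) u\<bar> \<le> C" if "u \<in> {t0..T}" for n u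
        using kC[OF elim(2) that] kp[OF that] by metis
      have klim: "(\<lambda>n. k (r (s n)) \<omega> u) \<longlonglongrightarrow> ka \<omega> u" if "u \<in> {t0..T}" for u
        unfolding kp[OF that] ka_def by (rule primitive_tendsto[OF aNi(1) elim(3) alim])
      have int_eq: "(\<integral>u. indicator {t0..t} u * (g u * exp (- k (r (s n)) \<omega> u)) \<partial>A.I)
          = (\<integral>u. indicator {t0..t} u * (g u * exp (- primitive t0 T (aN n) u)) \<partial>A.I)" for n g
        by (intro Bochner_Integration.integral_cong) (auto simp: kp)
      have Blim: "(\<lambda>n. \<integral>u. indicator {t0..t} u * (bN n u * exp (- k (r (s n)) \<omega> u)) \<partial>A.I)
          \<longlonglongrightarrow> (\<integral>u. indicator {t0..t} u * (b u \<omega> * exp (- ka \<omega> u)) \<partial>A.I)"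
        unfolding int_eq ka_def
        by (rule integral_exp_primitive_tendsto[OF aNi(1) elim(3) alim aNi(2) elim(4) blim pC])
      \<comment> \<open>The integrands \<open>sqrt (\<gamma> 1) * \<psi> 1\<close> form a constant
        sequence; only the exponent varies.\<close>
      have Dlim: "(\<lambda>n. D (r (s n)) \<omega>) \<longlonglongrightarrow> Da \<omega>"
        unfolding D_def Da_def int_eq ka_def
        by (rule integral_exp_primitive_tendsto[OF aNi(1) elim(3) alim \<psi>i \<psi>i _ pC]) simp_all
      \<comment> \<open>The bound on the exponents passes to the limit, so
        \<open>Da \<omega>\<close> is at least \<open>d0\<close> as well and the quotients
        \<open>W\<close> converge.\<close>
      have kaC: "\<bar>ka \<omega> u\<bar> \<le> C" if "u \<in> {t0..T}" for u
        using klim[OF that] kC[OF elim(2) that] by (intro LIMSEQ_le_const2[OF tendsto_rabs]) auto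
      have "ka \<omega> \<in> borel_measurable A.I" unfolding ka_def by (rule primitive_measurable[OF elim(3)])
      then have "d0 \<le> Da \<omega>" unfolding Da_def by (rule d0_le) (rule kaC)
      then have Da: "Da \<omega> \<noteq> 0" using d0 by linarith
      have "(\<lambda>n. W (r (s n)) \<omega>) \<longlonglongrightarrow> Wa \<omega>"
        unfolding W_def Wa_def by (intro tendsto_intros klim Dlim Da t)
      \<comment> \<open>On this path \<open>a\<close> is integrable, so the solution has the
        factored form and the limit can be taken factor by factor.\<close>
      moreover have "(\<lambda>n. X (r (s n)) \<omega>) \<longlonglongrightarrow> Xa \<omega>"
        unfolding X_def Xa_def sol_proc_eq[where T=T and a=a and \<omega>=\<omega>, OF t(3,2) elim(3)] ka_def[symmetric] bN_def[symmetric]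
        by (intro tendsto_intros klim Blim t)
      ultimately show ?case by simp
    qed
    with s(1) show ?thesis by blast
  qed
  \<comment> \<open>The integrand is almost surely bounded by \<open>B * c\<close>, hence the
    nonnegative integral is finite and equals the Bochner integral that
    \<open>distributed_limit\<close> expects.\<close>
  have dens: "distributed M lborel (X n)
      (\<lambda>x. ennreal (\<integral>\<omega>. f\<eta>1 (\<eta> 1 \<omega> + (x - X n \<omega>) * W n \<omega>) * W n \<omega> \<partial>M))" for n
  proof -
    have "(\<integral>\<^sup>+\<omega>. ennreal (f\<eta>1 (\<eta> 1 \<omega> + (x - X n \<omega>) * W n \<omega>) * W n \<omega>) \<partial>M)
      = ennreal (\<integral>\<omega>. f\<eta>1 (\<eta> 1 \<omega> + (x - X n \<omega>) * W n \<omega>) * W n \<omega> \<partial>M)" for x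
    proof (rule nn_integral_eq_integral)
      have "AE \<omega> in M. norm (f\<eta>1 (\<eta> 1 \<omega> + (x - X n \<omega>) * W n \<omega>) * W n \<omega>) \<le> B * c"
        using Wc[of n]
      proof eventually_elim
        case (elim \<omega>)
        have "0 \<le> B" using B[of 0] f\<eta>1(1) order_trans by blast
        with elim show ?case
          using B f\<eta>1(1) by (simp add: abs_mult mult_mono)
      qed
      then show "integrable M (\<lambda>\<omega>. f\<eta>1 (\<eta> 1 \<omega> + (x - X n \<omega>) * W n \<omega>) * W n \<omega>)"
        by (rule integrable_const_bound) measurable
      show "AE \<omega> in M. 0 \<le> f\<eta>1 (\<eta> 1 \<omega> + (x - X n \<omega>) * W n \<omega>) * W n \<omega>"
        using Wc[of n] f\<eta>1(1) by (auto elim!: eventually_mono)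
    qed
    with ndens[of n] show ?thesis by simp
  qed
  note lim = distributed_limit[where XN=X and WN=W and X=Xa and W=Wa and Y="\<eta> 1" and B=B and c=c, OF P Xm Wm Xam Wam \<eta>1m H3(1) f\<eta>1(1)[rule_format] B Wc sub dens]
  show "\<exists>f1t. (\<forall>x. 0 \<le> f1t x) \<and>
           distributed M lborel (sol_proc t0 x0 a b t) (\<lambda>x. ennreal (f1t x)) \<and>
           (\<forall>x. (\<lambda>N. f1_approx t0 f0 (fJ N) (mean_fun M a) na \<nu> \<phi> (mean_fun M b) nb \<gamma> \<psi> N x t) \<longlonglongrightarrow> f1t x)"
  proof (intro exI conjI allI)
    \<comment> \<open>The witness is the expectation formula of the approximations, taken at the
      limits \<open>Xa\<close> and \<open>Wa\<close>.\<close>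
    show "0 \<le> (\<integral>\<omega>. f\<eta>1 (\<eta> 1 \<omega> + (x - Xa \<omega>) * Wa \<omega>) * Wa \<omega> \<partial>M)" for x
      using lim(1) f\<eta>1(1) by (intro integral_nonneg_AE) (auto elim!: eventually_mono)
    show "distributed M lborel (sol_proc t0 x0 a b t)
        (\<lambda>x. ennreal (\<integral>\<omega>. f\<eta>1 (\<eta> 1 \<omega> + (x - Xa \<omega>) * Wa \<omega>) * Wa \<omega> \<partial>M))"
      using lim(3) unfolding Xa_def .
    \<comment> \<open>The formula describes the approximations of order \<open>Suc n\<close>;
      convergence of the shifted sequence is convergence of the original one.\<close>
    show "(\<lambda>N. f1_approx t0 f0 (fJ N) (mean_fun M a) na \<nu> \<phi> (mean_fun M b) nb \<gamma> \<psi> N x t)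
        \<longlonglongrightarrow> (\<integral>\<omega>. f\<eta>1 (\<eta> 1 \<omega> + (x - Xa \<omega>) * Wa \<omega>) * Wa \<omega> \<partial>M)" for x
      by (rule LIMSEQ_imp_Suc) (use lim(2)[of x] in \<open>simp only: approx\<close>)
  qed
qed

end
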